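(* Let $(N_t)_{t\ge0}$ be a branching process on $\mathbb N_0^*$ whose probability generating functions $(F_{s,t})_{(s,t)\in\Delta}$ form an absolutely continuous reverse evolution family in $\mathbb D$ with associated Herglotz vector field $\Phi(z,t)=q_tz+\sum_{n\in\mathbb N_0\setminus\{1\}}\alpha_t(n)(z-z^n)$, $(q_t,\alpha_t)$ a generating family. The following are equivalent: (1) $\mathbb E^{(s,n)}[N_t]<\infty$ for all $n\in\mathbb N$ and $(s,t)\in\Delta$; (2) $\mathbb E^{(0,1)}[N_t]<\infty$ for all $t\ge0$; (3) $F_{0,t}(1)=1$ and $F'_{0,t}(1)<\infty$ for all $t\ge0$; (4) $F_{s,t}(1)=1$ and $F'_{s,t}(1)<\infty$ for all $(s,t)\in\Delta$; (5) $\Phi(1,t)=0$ for a.e. $t\ge0$ and $t\mapsto\Phi'(1,t)$ is in $L^1_{\rm loc}$; (6) $q_t=0$ for a.e. $t\ge0$ and $t\mapsto\sum_{n\in\mathbb N_0\setminus\{1\}}(n+1)\alpha_t(n)$ is in $L^1_{\rm loc}$. If these hold, then $\mathbb E^{(s,n)}[N_t]=nF'_{s,t}(1)=n\exp\big(-\int_s^t\Phi'(1,r)\,\mathrm dr\big)$ for all $n\in\mathbb N$ and $(s,t)\in\Delta$.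
   Context: $\Delta=\{(s,t):0\le s\le t\}$, $\mathbb D=\{|z|<1\}$, $\mathbb N_0^*=\{0,1,2,\dots\}\cup\{\infty\}$; $L^1_{\rm loc}$: integrable on compact subintervals. A branching process on $\mathbb N_0^*$ is a Markov family $(N_t)$ (probabilities $\mathbb P^{(s,n)}$ with $\mathbb P^{(s,n)}[N_s=n]=1$ and Markov property $\mathbb E^{(s,n)}[f(N_u)|\mathcal F_{[s,t]}]=\int f(y)\ell_{t,u}(N_t,\mathrm dy)$) with transition kernels $(\ell_{s,t})$ on $\mathbb N_0^*$ satisfying $\ell_{s,s}(n,\cdot)=\delta_n$, $\ell_{s,t}\star\ell_{t,u}=\ell_{s,u}$, weak continuity of $(s,t)\mapsto\ell_{s,t}(n,\cdot)$ for $n\in\mathbb N_0$, $\ell_{s,t}(m,\cdot)\ast\ell_{s,t}(n,\cdot)=\ell_{s,t}(m+n,\cdot)$, $\ell_{s,t}(0,\cdot)=\delta_0$, $\ell_{s,t}(\infty,\cdot)=\delta_\infty$. Its probability generating functions: $F_{s,t}(z)=\sum_{n\ge0}\ell_{s,t}(1,\{n\})z^n$. Absolutely continuous reverse evolution family: $F_{s,s}={\rm id}$, $F_{s,u}=F_{s,t}\circ F_{t,u}$, $|F_{s,u}(z)-F_{s,t}(z)|\le\int_t^u f_z$ with $f_z\in L^1_{\rm loc}$; its associated Herglotz vector field $\Phi$ is the a.e.-unique function with $\frac{\mathrm d}{\mathrm ds}F_{s,t}(z)=\Phi(F_{s,t}(z),s)$ a.e. on $[0,t]$, and it has the stated form with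 $q_t\ge0$, $\alpha_t(n)\ge0$, $t\mapsto\alpha_t(n)$ measurable, $t\mapsto q_t$ and $t\mapsto\sum_n\alpha_t(n)$ in $L^1_{\rm loc}$. Notation: $F^{(n)}(1):=\lim_{\mathbb R\ni x\to1^-}F^{(n)}(x)$, $\Phi^{(n)}(1,t):=\lim_{\mathbb R\ni x\to1^-}\Phi^{(n)}(x,t)$ (spatial derivatives). *)

theory Defs
  imports "HOL-Probability.Probability"
begin

definition Delta :: "(real \<times> real) set" where
  "Delta = {(s,t). 0 \<le> s \<and> s \<le> t}"

text \<open>Transition kernels of a branching process on N0* (modelled by enat,
  with its order topology = one-point compactification).\<close>
definition branching_kernels :: "(real \<Rightarrow> real \<Rightarrow> enat \<Rightarrow> enat pmf) \<Rightarrow> bool" where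
  "branching_kernels K \<longleftrightarrow>
     (\<forall>s n. 0 \<le> s \<longrightarrow> K s s n = return_pmf n) \<and>
     (\<forall>s t u n. 0 \<le> s \<and> s \<le> t \<and> t \<le> u \<longrightarrow>
         K s u n = bind_pmf (K s t n) (\<lambda>m. K t u m)) \<and>
     (\<forall>n::nat. \<forall>f::enat \<Rightarrow> real. continuous_on UNIV f \<and> bounded (range f) \<longrightarrow>
         continuous_on Delta (\<lambda>(s,t). measure_pmf.expectation (K s t (enat n)) f)) \<and>
     (\<forall>s t m n. 0 \<le> s \<and> s \<le> t \<longrightarrow>
         K s t (m + n) = map_pmf (\<lambda>(a,b). a + b) (pair_pmf (K s t m) (K s t n))) \<and>
     (\<forall>s t. 0 \<le> s \<and> s \<le> t \<longrightarrow> K s t 0 = return_pmf 0) \<and>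
     (\<forall>s t. 0 \<le> s \<and> s \<le> t \<longrightarrow> K s t \<infinity> = return_pmf \<infinity>)"

definition nat_filtration :: "'w measure \<Rightarrow> (real \<Rightarrow> 'w \<Rightarrow> enat) \<Rightarrow> real \<Rightarrow> real \<Rightarrow> 'w measure" where
  "nat_filtration M N s t =
     sigma (space M) {N r -` A \<inter> space M | r A. s \<le> r \<and> r \<le> t}"

definition branching_process ::
  "(real \<Rightarrow> enat \<Rightarrow> 'w measure) \<Rightarrow> (real \<Rightarrow> 'w \<Rightarrow> enat) \<Rightarrow> (real \<Rightarrow> real \<Rightarrow> enat \<Rightarrow> enat pmf) \<Rightarrow> bool"
  where
  "branching_process P N K \<longleftrightarrow> branching_kernels K \<and>
     (\<forall>s n. 0 \<le> s \<longrightarrow>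
        prob_space (P s n) \<and>
        (\<forall>t. 0 \<le> t \<longrightarrow> N t \<in> measurable (P s n) (count_space UNIV)) \<and>
        measure (P s n) {\<omega> \<in> space (P s n). N s \<omega> = n} = 1 \<and>
        (\<forall>t u (f::enat \<Rightarrow> real). s \<le> t \<and> t \<le> u \<and> bounded (range f) \<longrightarrow>
           (AE \<omega> in P s n.
              real_cond_exp (P s n) (nat_filtration (P s n) N s t) (\<lambda>\<omega>. f (N u \<omega>)) \<omega>
              = measure_pmf.expectation (K t u (N t \<omega>)) f)))"

definition expect_N :: "(real \<Rightarrow> enat \<Rightarrow> 'w measure) \<Rightarrow> (real \<Rightarrow> 'w \<Rightarrow> enat) \<Rightarrow> real \<Rightarrow> enat \<Rightarrow> real \<Rightarrow> ennreal" where
  "expect_N P N s n t = (\<integral>\<^sup>+ \<omega>. ennreal_of_enat (N t \<omega>) \<partial>(P s n))"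

definition pgf :: "(real \<Rightarrow> real \<Rightarrow> enat \<Rightarrow> enat pmf) \<Rightarrow> real \<Rightarrow> real \<Rightarrow> complex \<Rightarrow> complex" where
  "pgf K s t z = (\<Sum>n. of_real (pmf (K s t 1) (enat n)) * z ^ n)"

definition L1_loc :: "(real \<Rightarrow> real) \<Rightarrow> bool" where
  "L1_loc f \<longleftrightarrow> (\<forall>T. set_integrable lborel {0..T} f)"

definition ac_reverse_evolution_family :: "(real \<Rightarrow> real \<Rightarrow> complex \<Rightarrow> complex) \<Rightarrow> bool" where
  "ac_reverse_evolution_family F \<longleftrightarrow>
     (\<forall>s t. 0 \<le> s \<and> s \<le> t \<longrightarrow> F s t holomorphic_on ball 0 1 \<and> F s t ` ball 0 1 \<subseteq> ball 0 1) \<and>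
     (\<forall>s z. 0 \<le> s \<and> z \<in> ball 0 1 \<longrightarrow> F s s z = z) \<and>
     (\<forall>s t u z. 0 \<le> s \<and> s \<le> t \<and> t \<le> u \<and> z \<in> ball 0 1 \<longrightarrow> F s u z = F s t (F t u z)) \<and>
     (\<forall>z \<in> ball 0 1. \<exists>f. L1_loc f \<and>
        (\<forall>s t u. 0 \<le> s \<and> s \<le> t \<and> t \<le> u \<longrightarrow>
           cmod (F s u z - F s t z) \<le> (LINT r:{t..u}|lborel. f r)))"

definition generating_family :: "(real \<Rightarrow> real) \<Rightarrow> (real \<Rightarrow> nat \<Rightarrow> real) \<Rightarrow> bool" where
  "generating_family q \<alpha> \<longleftrightarrow>
     (\<forall>t. 0 \<le> t \<longrightarrow> q t \<ge> 0) \<and> (\<forall>t n. 0 \<le> t \<longrightarrow> \<alpha> t n \<ge> 0) \<and>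
     (\<forall>n. (\<lambda>t. \<alpha> t n) \<in> borel_measurable lborel) \<and>
     L1_loc q \<and>
     (\<forall>T. (\<integral>\<^sup>+ t. indicator {0..T} t * (\<Sum>n. ennreal (if n = 1 then 0 else \<alpha> t n)) \<partial>lborel) < \<infinity>)"

definition herglotz :: "(real \<Rightarrow> real) \<Rightarrow> (real \<Rightarrow> nat \<Rightarrow> real) \<Rightarrow> complex \<Rightarrow> real \<Rightarrow> complex" where
  "herglotz q \<alpha> z t = of_real (q t) * z + (\<Sum>n. if n = 1 then 0 else of_real (\<alpha> t n) * (z - z ^ n))"

definition bval1 :: "(complex \<Rightarrow> complex) \<Rightarrow> complex" where
  "bval1 f = Lim (at_left (1::real)) (\<lambda>x. f (complex_of_real x))"

end

theory Submission
  imports Defs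
begin

text \<open>
  For real \<open>x < 1\<close> the function \<open>u(r) = F\<^sub>r\<^sub>,\<^sub>t(x)\<close> is absolutely continuous in \<open>r\<close> and solves
  \<open>u' = \<Phi>(u, r)\<close>, so that
  \<open>ln ((1 - F\<^sub>s\<^sub>,\<^sub>t(x)) / (1 - x))\<close> is the integral of \<open>\<Phi>(u(r), r) / (1 - u(r))\<close> over \<open>[s, t]\<close>.
  The integrand equals \<open>q y / (1 - y) + (\<Sum>n\<ge>2. \<alpha>(n) (y + \<dots> + y\<^sup>n\<^sup>-\<^sup>1)) - \<alpha>(0)\<close> at \<open>y = u(r)\<close>, which is
  increasing in \<open>y\<close>, while the difference quotient on the left increases to the mean of the offspring
  law as \<open>x\<close> tends to \<open>1\<close>. Monotone convergence therefore identifies the logarithm of the mean with the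
  integral of \<open>-\<Phi>'(1, r)\<close>, and one side is finite exactly if the other is.
\<close>

text \<open>The estimate in the definition of the evolution family concerns the later time at a
  fixed point, while the equation differentiates in the earlier time. The composition law turns an
  increment in the earlier time into the distance of a generating function from the identity at a
  moving point, so a bound uniform in the point is needed; the nonnegativity of the coefficients
  supplies it.

  The term \<alpha>(0) is the only negative one in the integrand. It is locally integrable for every
  generating family and is moved to the other side, so that all integrands are nonnegative and
  infinite values are harmless.

  The two directions differ. Bounding the integrand by its supremum gives finite means at once.
  Conversely, the integrand is known to reach its supremum only when u(r) tends to 1 for every r in
  [s, t], which uses finite means from every intermediate time r. If only the means from time 0 are
  known to be finite, conditioning on the state at time r supplies the others, because that state is
  nonzero with positive probability.\<close>

section \<open>The fundamental theorem of calculus for absolutely continuous functions\<close>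

text \<open>On the exceptional set the derivative and the dominating function \<open>g\<close> are replaced by zero; the
  Henstock lemma for \<open>g\<close> then bounds the total increment over the intervals tagged there.\<close>

lemma has_integral_of_absolutely_continuous:
  fixes h h' g :: "real \<Rightarrow> real"
  assumes ab: "a \<le> b"
    and g: "g integrable_on {a..b}"
    and ac: "\<And>u v. a \<le> u \<Longrightarrow> u \<le> v \<Longrightarrow> v \<le> b \<Longrightarrow> \<bar>h v - h u\<bar> \<le> integral {u..v} g"
    and S: "negligible S"
    and deriv: "\<And>x. x \<in> {a..b} - S \<Longrightarrow> (h has_vector_derivative h' x) (at x within {a..b})"
  shows "(h' has_integral (h b - h a)) {a..b}"
proof -
  define g0 where "g0 = (\<lambda>x. if x \<in> S then 0 else g x)"
  define k where "k = (\<lambda>x. if x \<in> S then 0 else h' x)"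
  have g0: "g0 integrable_on cbox a b"
    using g by (auto simp: g0_def intro: integrable_spike[OF _ S])
  have g0_eq: "integral K g0 = integral K g" for K
    by (rule integral_spike[OF S]) (auto simp: g0_def)
  have "(k has_integral (h b - h a)) (cbox a b)"
    unfolding has_integral
  proof safe
    fix e :: real assume e: "e > 0"
    \<comment> \<open>Half of \<open>e\<close> is reserved for tags outside \<open>S\<close>, whose
      intervals have total length at most \<open>b - a\<close>; the \<open>+ 1\<close> keeps the
      divisor positive when \<open>a = b\<close>.\<close>
    define e1 where "e1 = e / (2 * (b - a + 1))"
    have e1: "e1 > 0" using e ab by (simp add: e1_def)
    obtain \<gamma> where \<gamma>: "gauge \<gamma>"
      and \<gamma>_less: "\<And>p. \<lbrakk>p tagged_partial_division_of (cbox a b); \<gamma> fine p\<rbrakk> \<Longrightarrow>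
             (\<Sum>(x,K)\<in>p. norm (measure lborel K *\<^sub>R g0 x - integral K g0)) < e / 2"
      using Henstock_lemma[OF g0, of "e / 2"] e by auto
    have "\<forall>x. \<exists>d>0. x \<in> {a..b} - S \<longrightarrow>
         (\<forall>y\<in>{a..b}. norm (y-x) < d \<longrightarrow> norm (h y - h x - (y-x) *\<^sub>R h' x) \<le> e1 * norm (y-x))"
      using deriv[unfolded has_vector_derivative_def has_derivative_within_alt] e1 by blast
    then obtain d where d: "\<And>x. 0 < d x"
         "\<And>x y. \<lbrakk>x \<in> {a..b} - S; y \<in> {a..b}; norm (y-x) < d x\<rbrakk>
                        \<Longrightarrow> norm (h y - h x - (y-x) *\<^sub>R h' x) \<le> e1 * norm (y-x)"
      by metis
    have "norm ((\<Sum>(x, K)\<in>p. measure lborel K *\<^sub>R k x) - (h b - h a)) < e"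
      if p: "p tagged_division_of cbox a b" and fine: "(\<lambda>x. ball x (d x) \<inter> \<gamma> x) fine p" for p
    proof -
      have ba: "b - a = (\<Sum>(x,K)\<in>p. Sup K - Inf K)" "h b - h a = (\<Sum>(x,K)\<in>p. h (Sup K) - h (Inf K))"
        using additive_tagged_division_1[where f= "\<lambda>x. x"] additive_tagged_division_1[where f= h]
            ab p by auto
      have "norm ((\<Sum>(x, K)\<in>p. measure lborel K *\<^sub>R k x) - (h b - h a))
          = norm (\<Sum>(x, K)\<in>p. measure lborel K *\<^sub>R k x - (h (Sup K) - h (Inf K)))"
        unfolding ba(2) by (simp add: sum_subtractf case_prod_beta)
      also have "\<dots> \<le> (\<Sum>xK\<in>p. e1 * (case xK of (x,K) \<Rightarrow> Sup K - Inf K)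
                 + (case xK of (x,K) \<Rightarrow> norm (measure lborel K *\<^sub>R g0 x - integral K g0)))"
      proof (rule sum_norm_le, safe)
        fix x K assume xK: "(x, K) \<in> p"
        then obtain u v where K: "K = cbox u v" and xin: "x \<in> K" and sub: "K \<subseteq> cbox a b"
          using p by blast
        have uv: "u \<le> v" "u \<in> K" "v \<in> K" using xin K by auto
        have bnds: "Sup K = v" "Inf K = u" "measure lborel K = v - u" using K uv(1) by auto
        have aubv: "a \<le> u" "v \<le> b" "x \<in> {a..b}" using sub uv xin by auto
        show "norm (measure lborel K *\<^sub>R k x - (h (Sup K) - h (Inf K)))
           \<le> e1 * (Sup K - Inf K) + norm (measure lborel K *\<^sub>R g0 x - integral K g0)"
        proof (cases "x \<in> S")
          case True
          have "\<bar>h v - h u\<bar> \<le> integral {u..v} g" by (rule ac) (use aubv uv in auto)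
          moreover have "0 \<le> e1 * (v - u)" using e1 uv by simp
          moreover have "integral K g0 = integral {u..v} g" by (simp add: g0_eq K)
          moreover have "g0 x = 0" "k x = 0" using True by (simp_all add: g0_def k_def)
          ultimately show ?thesis by (simp add: bnds abs_minus_commute)
        next
          case False
          have ball: "y \<in> ball x (d x)" if "y \<in> K" for y
            using fineD[OF fine xK] that by auto
          have "norm (h u - h x - (u - x) *\<^sub>R h' x) \<le> e1 * norm (u - x)"
            by (rule d) (use ball[OF uv(2)] False aubv uv in \<open>auto simp: dist_real_def\<close>)
          moreover have "norm (h v - h x - (v - x) *\<^sub>R h' x) \<le> e1 * norm (v - x)"
            by (rule d) (use ball[OF uv(3)] False aubv uv in \<open>auto simp: dist_real_def\<close>)
          \<comment> \<open>The tag lies between the endpoints, so the two error bounds add up to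
            \<open>e1 * (v - u)\<close>.\<close>
          moreover have "norm (u - x) = x - u" "norm (v - x) = v - x" using xin K by auto
          ultimately have "norm ((v - u) *\<^sub>R h' x - (h v - h u)) \<le> e1 * (v - u)"
            by (auto simp: algebra_simps abs_le_iff)
          then show ?thesis using False by (simp add: bnds k_def add_increasing2)
        qed
      qed
      also have "\<dots> = e1 * (b - a) + (\<Sum>(x,K)\<in>p. norm (measure lborel K *\<^sub>R g0 x - integral K g0))"
        unfolding ba(1) by (simp add: sum.distrib sum_distrib_left)
      also have "\<dots> < e / 2 + e / 2"
      proof (rule add_le_less_mono)
        have "e1 * (b - a) \<le> e1 * (b - a + 1)" using e1 by simp
        also have "\<dots> = e / 2" using ab by (simp add: e1_def field_simps)
        finally show "e1 * (b - a) \<le> e / 2" .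
        show "(\<Sum>(x,K)\<in>p. norm (measure lborel K *\<^sub>R g0 x - integral K g0)) < e / 2"
          by (rule \<gamma>_less) (use p fine in \<open>auto simp: tagged_division_of_def fine_def\<close>)
      qed
      finally show ?thesis by simp
    qed
    moreover have "gauge (\<lambda>x. ball x (d x) \<inter> \<gamma> x)"
      using d(1) \<gamma> by (intro gauge_Int gauge_ball_dependent) auto
    ultimately show "\<exists>\<gamma>. gauge \<gamma> \<and> (\<forall>\<D>. \<D> tagged_division_of cbox a b \<and> \<gamma> fine \<D> \<longrightarrow>
          norm ((\<Sum>(x, K)\<in>\<D>. measure lborel K *\<^sub>R k x) - (h b - h a)) < e)"
      by blast
  qed
  then show ?thesis
    by (auto simp: k_def intro: has_integral_spike[OF S, rotated])
qed

section \<open>Power series with nonnegative coefficients at the boundary point 1\<close>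

lemma tannery_at_left:
  fixes f :: "nat \<Rightarrow> real \<Rightarrow> real"
  assumes lim: "\<And>n. ((\<lambda>x. f n x) \<longlongrightarrow> b n) (at_left 1)"
    and bound: "\<And>n x. 0 < x \<Longrightarrow> x < 1 \<Longrightarrow> \<bar>f n x\<bar> \<le> m n" and m: "summable m"
  shows "((\<lambda>x. \<Sum>n. f n x) \<longlongrightarrow> (\<Sum>n. b n)) (at_left (1::real))"
proof -
  have "eventually (\<lambda>(k,x). norm (f k x) \<le> m k) (at_top \<times>\<^sub>F at_left 1)"
    unfolding eventually_prod_filter
    by (rule exI[of _ "\<lambda>_. True"], rule exI[of _ "\<lambda>x. x \<in> {0<..<1}"])
       (use bound eventually_at_left_real[OF zero_less_one] in auto)
  from tannerys_theorem[OF lim this m] show ?thesis by simp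
qed

lemma summable_powser_nonneg:
  fixes c :: "nat \<Rightarrow> real" and z :: "'a::{real_normed_field,banach}"
  assumes c: "\<And>n. 0 \<le> c n" "summable c" and z: "norm z \<le> 1"
  shows "summable (\<lambda>n. of_real (c n) * z ^ n)"
  by (rule summable_comparison_test'[OF c(2), of 0])
     (use c z in \<open>auto simp: norm_mult norm_power intro!: mult_left_le power_le_one\<close>)

lemmas summable_powser_nonneg_real = summable_powser_nonneg[where 'a=real, simplified]

lemma powser_complex_of_real:
  fixes c :: "nat \<Rightarrow> real"
  assumes c: "summable (\<lambda>n. c n * x ^ n)"
  shows "(\<Sum>n. complex_of_real (c n) * complex_of_real x ^ n) = complex_of_real (\<Sum>n. c n * x ^ n)"
proof -
  have "complex_of_real (\<Sum>n. c n * x ^ n) = (\<Sum>n. complex_of_real (c n * x ^ n))"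
    by (rule bounded_linear.suminf[OF bounded_linear_of_real c])
  then show ?thesis by simp
qed

lemma powser_tendsto_suminf:
  fixes c :: "nat \<Rightarrow> real"
  assumes c: "\<And>n. 0 \<le> c n" "summable c"
  shows "((\<lambda>x. \<Sum>n. c n * x ^ n) \<longlongrightarrow> (\<Sum>n. c n)) (at_left 1)"
proof (rule tannery_at_left[OF _ _ c(2)])
  show "((\<lambda>x. c n * x ^ n) \<longlongrightarrow> c n) (at_left 1)" for n
    by (auto intro!: tendsto_eq_intros)
  show "\<bar>c n * x ^ n\<bar> \<le> c n" if "0 < x" "x < 1" for n x
    using that c by (auto simp: abs_mult intro!: mult_left_le power_le_one)
qed

text \<open>A converse of Abel's theorem for nonnegative terms: a finite partial sum is continuous
  at 1 and lies below the full series on (0, 1), so the limit bounds every partial sum.\<close>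

lemma summable_of_powser_tendsto:
  fixes d :: "nat \<Rightarrow> real"
  assumes d: "\<And>n. 0 \<le> d n" "\<And>x. 0 < x \<Longrightarrow> x < 1 \<Longrightarrow> summable (\<lambda>n. d n * x ^ n)"
    and L: "((\<lambda>x. \<Sum>n. d n * x ^ n) \<longlongrightarrow> L) (at_left 1)"
  shows "summable d"
proof (rule summableI_nonneg_bounded[of _ L])
  fix k
  have "((\<lambda>x. \<Sum>n<k. d n * x ^ n) \<longlongrightarrow> (\<Sum>n<k. d n * 1 ^ n)) (at_left 1)"
    by (auto intro!: tendsto_eq_intros)
  moreover have "eventually (\<lambda>x. (\<Sum>n<k. d n * x ^ n) \<le> (\<Sum>n. d n * x ^ n)) (at_left 1)"
    using eventually_at_left_real[OF zero_less_one]
    by eventually_elim (use d in \<open>auto intro!: sum_le_suminf\<close>)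
  ultimately show "(\<Sum>i<k. d i) \<le> L"
    using tendsto_le[OF trivial_limit_at_left_real L] by simp
qed (use d in auto)

lemma deriv_powser_of_real:
  fixes c :: "nat \<Rightarrow> real"
  assumes c: "\<And>n. 0 \<le> c n" "summable c" and z: "norm (z::complex) < 1"
  shows "((\<lambda>z. \<Sum>n. complex_of_real (c n) * z ^ n) has_field_derivative
          (\<Sum>n. complex_of_real (diffs c n) * z ^ n)) (at z)"
proof -
  have "summable (\<lambda>n. complex_of_real (c n) * 1 ^ n)"
    using summable_powser_nonneg[OF c, of "1::complex"] by simp
  from termdiffs_strong[OF this, of z] z show ?thesis
    by (simp add: diffs_def)
qed

lemma summable_diffs_nonneg:
  fixes c :: "nat \<Rightarrow> real"
  assumes c: "\<And>n. 0 \<le> c n" "summable c" and x: "0 < x" "x < (1::real)"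
  shows "summable (\<lambda>n. diffs c n * x ^ n)"
  by (rule termdiff_converges[where K=1])
     (use x summable_powser_nonneg_real[OF c] in auto)

text \<open>The second claim accepts any complex limit and uses only its real part, so mere
  existence of a boundary derivative yields the first moment. Since \<open>diffs c n\<close> is the
  term of index \<open>n + 1\<close> of the first moment, the shift loses only the zero term at
  index 0.\<close>

lemma deriv_powser_tendsto:
  fixes c :: "nat \<Rightarrow> real"
  assumes c: "\<And>n. 0 \<le> c n" "summable c"
  defines "G \<equiv> (\<lambda>z. \<Sum>n. complex_of_real (c n) * z ^ n)"
  shows "summable (\<lambda>n. real n * c n) \<Longrightarrow>
           ((\<lambda>x. deriv G (complex_of_real x)) \<longlongrightarrow> complex_of_real (\<Sum>n. real n * c n)) (at_left 1)"
    and "((\<lambda>x. deriv G (complex_of_real x)) \<longlongrightarrow> L) (at_left 1) \<Longrightarrow> summable (\<lambda>n. real n * c n)"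
proof -
  have ev: "eventually (\<lambda>x. complex_of_real (\<Sum>n. diffs c n * x ^ n)
              = deriv G (complex_of_real x)) (at_left 1)"
    using eventually_at_left_real[OF zero_less_one]
  proof eventually_elim
    case (elim x)
    then have x: "0 < x" "x < 1" by auto
    have "deriv G (complex_of_real x) = (\<Sum>n. complex_of_real (diffs c n) * complex_of_real x ^ n)"
      unfolding G_def by (rule DERIV_imp_deriv[OF deriv_powser_of_real[OF c]]) (use x in auto)
    also have "\<dots> = complex_of_real (\<Sum>n. diffs c n * x ^ n)"
      by (rule powser_complex_of_real[OF summable_diffs_nonneg[OF c x]])
    finally show ?case by simp
  qed
  have diffs0: "0 \<le> diffs c n" for n using c by (simp add: diffs_def)
  have summable_iff: "summable (diffs c) \<longleftrightarrow> summable (\<lambda>n. real n * c n)"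
    using summable_Suc_iff[of "\<lambda>n. real n * c n"] by (simp add: diffs_def)
  {
    assume s: "summable (\<lambda>n. real n * c n)"
    have "(\<Sum>n. diffs c n) = (\<Sum>n. real n * c n)"
      using suminf_split_head[OF s] by (simp add: diffs_def)
    then have "((\<lambda>x. \<Sum>n. diffs c n * x ^ n) \<longlongrightarrow> (\<Sum>n. real n * c n)) (at_left 1)"
      using powser_tendsto_suminf[of "diffs c"] diffs0 s summable_iff by simp
    then show "((\<lambda>x. deriv G (complex_of_real x)) \<longlongrightarrow> complex_of_real (\<Sum>n. real n * c n)) (at_left 1)"
      by (intro Lim_transform_eventually[OF _ ev] tendsto_of_real)
  }
  assume "((\<lambda>x. deriv G (complex_of_real x)) \<longlongrightarrow> L) (at_left 1)"
  then have "((\<lambda>x. complex_of_real (\<Sum>n. diffs c n * x ^ n)) \<longlongrightarrow> L) (at_left 1)"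
    by (rule Lim_transform_eventually) (use ev in \<open>auto elim: eventually_mono\<close>)
  from tendsto_Re[OF this] have "((\<lambda>x. \<Sum>n. diffs c n * x ^ n) \<longlongrightarrow> Re L) (at_left 1)" by simp
  from summable_of_powser_tendsto[OF diffs0 summable_diffs_nonneg[OF c] this]
  show "summable (\<lambda>n. real n * c n)" using summable_iff by simp
qed

text \<open>Dividing termwise and summing \<open>(1 - x ^ n) / (1 - x)\<close> as a geometric
  progression exhibits the difference quotient at 1 as a series of nonnegative terms whose termwise
  limits are \<open>real n * p n\<close>.\<close>

lemma suminf_minus_powser:
  fixes p :: "nat \<Rightarrow> real"
  assumes p: "\<And>n. 0 \<le> p n" "summable p" and x: "0 \<le> x" "x < 1"
  shows "(\<lambda>n. p n * (\<Sum>j<n. x ^ j)) sums (((\<Sum>n. p n) - (\<Sum>n. p n * x ^ n)) / (1 - x))"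
proof -
  have "(\<lambda>n. (p n - p n * x ^ n) / (1 - x)) sums (((\<Sum>n. p n) - (\<Sum>n. p n * x ^ n)) / (1 - x))"
    using p x by (intro sums_divide sums_diff summable_sums summable_powser_nonneg_real) auto
  moreover have "(p n - p n * x ^ n) / (1 - x) = p n * (\<Sum>j<n. x ^ j)" for n
    using x by (simp add: sum_gp_strict divide_simps) (simp add: algebra_simps)
  ultimately show ?thesis by simp
qed

text \<open>The numerator starts from 1 rather than from the total mass. Hence the bound also kills
  the mass defect: it is at most \<open>C * (1 - x)\<close> in the limit. After that, finite pieces
  of the geometric-sum series stay below \<open>C\<close> and pass to the limit.\<close>

lemma summable_of_difference_quotient_bounded:
  fixes p :: "nat \<Rightarrow> real"
  assumes p: "\<And>n. 0 \<le> p n" "summable p" "(\<Sum>n. p n) \<le> 1"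
    and C: "\<And>x. 0 < x \<Longrightarrow> x < 1 \<Longrightarrow> (1 - (\<Sum>n. p n * x ^ n)) / (1 - x) \<le> C"
  shows "(\<Sum>n. p n) = 1" and "summable (\<lambda>n. real n * p n)"
proof -
  have "((\<lambda>x. 1 - (\<Sum>n. p n * x ^ n)) \<longlongrightarrow> 1 - (\<Sum>n. p n)) (at_left 1)"
    by (intro tendsto_intros powser_tendsto_suminf p)
  moreover have "((\<lambda>x. C * (1 - x)) \<longlongrightarrow> C * (1 - 1)) (at_left (1::real))"
    by (intro tendsto_intros)
  moreover have "eventually (\<lambda>x. 1 - (\<Sum>n. p n * x ^ n) \<le> C * (1 - x)) (at_left 1)"
    using eventually_at_left_real[OF zero_less_one]
    by eventually_elim (use C in \<open>auto simp: pos_divide_le_eq\<close>)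
  ultimately have "1 - (\<Sum>n. p n) \<le> C * (1 - 1)"
    using tendsto_le[OF trivial_limit_at_left_real] by blast
  with p show one: "(\<Sum>n. p n) = 1" by simp
  show "summable (\<lambda>n. real n * p n)"
  proof (rule summableI_nonneg_bounded[of _ C])
    fix k
    have "((\<lambda>x. \<Sum>n<k. p n * (\<Sum>j<n. x ^ j)) \<longlongrightarrow> (\<Sum>n<k. p n * (\<Sum>j<n. 1 ^ j))) (at_left (1::real))"
      by (intro tendsto_intros)
    moreover have "eventually (\<lambda>x. (\<Sum>n<k. p n * (\<Sum>j<n. x ^ j)) \<le> C) (at_left (1::real))"
      using eventually_at_left_real[OF zero_less_one]
    proof eventually_elim
      case (elim x)
      then have x: "0 < x" "x < 1" by auto
      note s = suminf_minus_powser[OF p(1,2), of x]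
      have "(\<Sum>n<k. p n * (\<Sum>j<n. x ^ j)) \<le> (\<Sum>n. p n * (\<Sum>j<n. x ^ j))"
        using s x p by (intro sum_le_suminf) (auto simp: sums_iff intro!: mult_nonneg_nonneg sum_nonneg)
      also have "\<dots> \<le> C" using s x C[of x] one by (simp add: sums_iff)
      finally show ?case .
    qed
    ultimately have "(\<Sum>n<k. p n * (\<Sum>j<n. 1 ^ j)) \<le> C"
      using tendsto_le[OF trivial_limit_at_left_real tendsto_const] by blast
    then show "(\<Sum>i<k. real i * p i) \<le> C" by (simp add: mult.commute)
  qed (use p in auto)
qed

lemma difference_quotient_tendsto:
  fixes p :: "nat \<Rightarrow> real"
  assumes p: "\<And>n. 0 \<le> p n" "summable p" "(\<Sum>n. p n) = 1" and s: "summable (\<lambda>n. real n * p n)"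
  shows "((\<lambda>x. (1 - (\<Sum>n. p n * x ^ n)) / (1 - x)) \<longlongrightarrow> (\<Sum>n. real n * p n)) (at_left 1)"
proof -
  have "((\<lambda>x. \<Sum>n. p n * (\<Sum>j<n. x ^ j)) \<longlongrightarrow> (\<Sum>n. real n * p n)) (at_left (1::real))"
  proof (rule tannery_at_left[OF _ _ s])
    show "((\<lambda>x. p n * (\<Sum>j<n. x ^ j)) \<longlongrightarrow> real n * p n) (at_left (1::real))" for n
      by (auto intro!: tendsto_eq_intros)
    show "\<bar>p n * (\<Sum>j<n. x ^ j)\<bar> \<le> real n * p n" if "0 < x" "x < 1" for n and x :: real
    proof -
      have "(\<Sum>j<n. x ^ j) \<le> (\<Sum>j<n. 1)"
        using that by (intro sum_mono power_le_one) auto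
      moreover have "0 \<le> (\<Sum>j<n. x ^ j)" using that by (intro sum_nonneg) auto
      ultimately show ?thesis using p(1)[of n]
        by (simp add: abs_mult mult.commute[of "real n"] mult_left_mono)
    qed
  qed
  moreover have "eventually (\<lambda>x. (\<Sum>n. p n * (\<Sum>j<n. x ^ j))
      = (1 - (\<Sum>n. p n * x ^ n)) / (1 - x)) (at_left 1)"
    using eventually_at_left_real[OF zero_less_one]
    by eventually_elim (use suminf_minus_powser[OF p(1,2)] p(3) in \<open>auto simp: sums_iff\<close>)
  ultimately show ?thesis by (rule Lim_transform_eventually)
qed

section \<open>Means of the transition kernels\<close>

text \<open>Kept in \<open>ennreal\<close>, so that additivity and conditioning hold without
  integrability conditions.\<close>

definition pmf_mean :: "enat pmf \<Rightarrow> ennreal" where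
  "pmf_mean M = (\<integral>\<^sup>+ m. ennreal_of_enat m \<partial>measure_pmf M)"

lemma nn_integral_enat_pmf:
  fixes M :: "enat pmf"
  shows "(\<integral>\<^sup>+ m. f m \<partial>measure_pmf M)
     = (\<Sum>n. ennreal (pmf M (enat n)) * f (enat n)) + ennreal (pmf M \<infinity>) * f \<infinity>"
proof -
  let ?g = "\<lambda>m. ennreal (pmf M m) * f m"
  have "(\<integral>\<^sup>+ m. f m \<partial>measure_pmf M) = (\<integral>\<^sup>+ m. ?g m \<partial>count_space UNIV)"
    by (rule nn_integral_measure_pmf)
  also have "\<dots> = (\<integral>\<^sup>+ m. ?g m * indicator (range enat) m + ?g m * indicator {\<infinity>} m \<partial>count_space UNIV)"
    by (intro nn_integral_cong) (auto simp: indicator_def image_iff)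
  also have "\<dots> = (\<integral>\<^sup>+ m. ?g m * indicator (range enat) m \<partial>count_space UNIV)
       + (\<integral>\<^sup>+ m. ?g m * indicator {\<infinity>} m \<partial>count_space UNIV)"
    by (rule nn_integral_add) auto
  also have "(\<integral>\<^sup>+ m. ?g m * indicator (range enat) m \<partial>count_space UNIV)
      = (\<integral>\<^sup>+ m. ?g m \<partial>count_space (range enat))"
    by (simp add: nn_integral_count_space_indicator)
  also have "\<dots> = (\<integral>\<^sup>+ n. ?g (enat n) \<partial>count_space UNIV)"
    by (rule nn_integral_bij_count_space[symmetric]) (auto simp: bij_betw_def inj_on_def)
  also have "\<dots> = (\<Sum>n. ?g (enat n))" by (rule nn_integral_count_space_nat)
  also have "(\<integral>\<^sup>+ m. ?g m * indicator {\<infinity>} m \<partial>count_space UNIV) = ?g \<infinity>"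
    by (subst nn_integral_indicator_singleton) auto
  finally show ?thesis .
qed

text \<open>A generating function sees only the finite states, so its value at 1 falls short of 1 by
  exactly the mass at infinity.\<close>

lemma pmf_enat_sums: "(\<lambda>n. pmf M (enat n)) sums (1 - pmf M \<infinity>)"
proof -
  have eq: "(\<Sum>n. ennreal (pmf M (enat n))) + ennreal (pmf M \<infinity>) = 1"
    using nn_integral_enat_pmf[of M "\<lambda>_. 1", symmetric] by simp
  then have fin: "(\<Sum>n. ennreal (pmf M (enat n))) \<noteq> top" by auto
  then have s: "summable (\<lambda>n. pmf M (enat n))" by (intro summable_suminf_not_top) auto
  have "ennreal ((\<Sum>n. pmf M (enat n)) + pmf M \<infinity>) = ennreal 1"
    using eq fin s by (simp add: suminf_nonneg)
  then have "(\<Sum>n. pmf M (enat n)) + pmf M \<infinity> = 1"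
    using suminf_nonneg[OF s] by (subst (asm) ennreal_inj) auto
  with s show ?thesis by (simp add: sums_iff)
qed

text \<open>In \<open>ennreal\<close> zero times infinity is zero, so the point at infinity is
  harmless exactly when it carries no mass.\<close>

lemma pmf_mean_finite_iff:
  "pmf_mean M < \<infinity> \<longleftrightarrow> pmf M \<infinity> = 0 \<and> summable (\<lambda>n. real n * pmf M (enat n))"
  and pmf_mean_eq: "pmf_mean M < \<infinity> \<Longrightarrow> pmf_mean M = ennreal (\<Sum>n. real n * pmf M (enat n))"
proof -
  have eq: "pmf_mean M = (\<Sum>n. ennreal (real n * pmf M (enat n))) + ennreal (pmf M \<infinity>) * \<infinity>"
    unfolding pmf_mean_def nn_integral_enat_pmf
    by (simp add: ennreal_mult' ennreal_of_nat_eq_real_of_nat mult.commute)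
  show iff: "pmf_mean M < \<infinity> \<longleftrightarrow> pmf M \<infinity> = 0 \<and> summable (\<lambda>n. real n * pmf M (enat n))"
  proof
    assume fin: "pmf_mean M < \<infinity>"
    then have "(\<Sum>n. ennreal (real n * pmf M (enat n))) \<noteq> top"
      and "ennreal (pmf M \<infinity>) * \<infinity> \<noteq> top"
      unfolding eq by (auto simp: less_top)
    then show "pmf M \<infinity> = 0 \<and> summable (\<lambda>n. real n * pmf M (enat n))"
      using summable_suminf_not_top[of "\<lambda>n. real n * pmf M (enat n)"]
      by (auto simp: ennreal_mult_eq_top_iff)
  next
    assume "pmf M \<infinity> = 0 \<and> summable (\<lambda>n. real n * pmf M (enat n))"
    then show "pmf_mean M < \<infinity>" unfolding eq by (simp add: suminf_ennreal2)
  qed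
  assume "pmf_mean M < \<infinity>"
  with iff show "pmf_mean M = ennreal (\<Sum>n. real n * pmf M (enat n))"
    unfolding eq by (simp add: suminf_ennreal2)
qed

text \<open>The Markov property is applied with conditioning on the degenerate interval [s, s]: the
  conditional probability is the kernel evaluated at \<open>N s\<close>, which is almost surely
  \<open>n\<close>, and taking expectations gives the law of \<open>N t\<close>. This reduces all
  expectations of the process to means of the kernels.\<close>

lemma distr_branching_process:
  assumes bp: "branching_process P N K" and st: "0 \<le> s" "s \<le> t"
  shows "distr (P s n) (count_space UNIV) (N t) = measure_pmf (K s t n)"
proof -
  interpret prob_space "P s n" using bp st by (auto simp: branching_process_def)
  have meas: "N r \<in> measurable (P s n) (count_space UNIV)" if "0 \<le> r" for r
    using bp st that by (auto simp: branching_process_def)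
  note [measurable] = meas[of t]
  define F where "F = nat_filtration (P s n) N s s"
  have sub: "subalgebra (P s n) F"
  proof -
    let ?G = "{N r -` A \<inter> space (P s n) | r A. s \<le> r \<and> r \<le> s}"
    have "?G \<subseteq> events" using measurable_sets[OF meas] st by auto
    then have "sigma_sets (space (P s n)) ?G \<subseteq> events" by (rule sets.sigma_sets_subset)
    moreover have G: "?G \<subseteq> Pow (space (P s n))" by auto
    ultimately show ?thesis
      unfolding subalgebra_def F_def nat_filtration_def
      by (simp only: sets_measure_of[OF G] space_measure_of[OF G] simp_thms)
  qed
  interpret finite_measure_subalgebra "P s n" F
    by unfold_locales (rule sub)
  have start: "AE \<omega> in P s n. N s \<omega> = n"
  proof -
    have "{\<omega> \<in> space (P s n). N s \<omega> = n} = N s -` {n} \<inter> space (P s n)" by auto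
    then have "{\<omega> \<in> space (P s n). N s \<omega> = n} \<in> events" using meas[OF st(1)] by simp
    moreover have "prob {\<omega> \<in> space (P s n). N s \<omega> = n} = 1"
      using bp st by (simp add: branching_process_def)
    ultimately show ?thesis by (subst (asm) prob_Collect_eq_1)
  qed
  have law: "prob (N t -` A \<inter> space (P s n)) = measure_pmf.prob (K s t n) A" for A
  proof -
    let ?f = "indicat_real A"
    have bnd: "bounded (range ?f)" by (rule boundedI[of _ 1]) (auto simp: indicator_def)
    have "\<forall>t u (f::enat \<Rightarrow> real). s \<le> t \<and> t \<le> u \<and> bounded (range f) \<longrightarrow>
           (AE \<omega> in P s n.
              real_cond_exp (P s n) (nat_filtration (P s n) N s t) (\<lambda>\<omega>. f (N u \<omega>)) \<omega>
              = measure_pmf.expectation (K t u (N t \<omega>)) f)"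
      using bp st unfolding branching_process_def by blast
    from this[rule_format, of s t ?f]
    have "AE \<omega> in P s n. real_cond_exp (P s n) F (\<lambda>\<omega>. ?f (N t \<omega>)) \<omega>
              = measure_pmf.expectation (K s t (N s \<omega>)) ?f"
      using st bnd by (simp add: F_def)
    with start have ae: "AE \<omega> in P s n. real_cond_exp (P s n) F (\<lambda>\<omega>. ?f (N t \<omega>)) \<omega>
              = measure_pmf.prob (K s t n) A"
      by eventually_elim simp
    have int: "integrable (P s n) (\<lambda>\<omega>. ?f (N t \<omega>))"
      by (rule integrable_const_bound[of _ 1]) (use st in auto)
    have "prob (N t -` A \<inter> space (P s n)) = (\<integral>\<omega>. indicat_real (N t -` A \<inter> space (P s n)) \<omega> \<partial>P s n)"
      by simp
    also have "\<dots> = (\<integral>\<omega>. ?f (N t \<omega>) \<partial>P s n)"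
      by (rule Bochner_Integration.integral_cong) (auto simp: indicator_def)
    also have "\<dots> = (\<integral>\<omega>. real_cond_exp (P s n) F (\<lambda>\<omega>. ?f (N t \<omega>)) \<omega> \<partial>P s n)"
      using real_cond_exp_int(2)[OF int] by simp
    also have "\<dots> = (\<integral>\<omega>. measure_pmf.prob (K s t n) A \<partial>P s n)"
      by (rule integral_cong_AE) (use ae in auto)
    finally show ?thesis by (simp add: prob_space)
  qed
  show ?thesis
  proof (rule measure_eqI)
    fix A assume "A \<in> sets (distr (P s n) (count_space UNIV) (N t))"
    show "emeasure (distr (P s n) (count_space UNIV) (N t)) A = emeasure (measure_pmf (K s t n)) A"
      using st law[of A]
      by (simp add: emeasure_distr emeasure_eq_measure measure_pmf.emeasure_eq_measure)
  qed auto
qed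

lemma expect_N_eq_pmf_mean:
  assumes bp: "branching_process P N K" and st: "0 \<le> s" "s \<le> t"
  shows "expect_N P N s n t = pmf_mean (K s t n)"
proof -
  have [measurable]: "N t \<in> measurable (P s n) (count_space UNIV)"
    using bp st by (auto simp: branching_process_def)
  show ?thesis
    unfolding expect_N_def pmf_mean_def distr_branching_process[OF bp st, symmetric]
    by (subst nn_integral_distr) auto
qed

lemma pmf_mean_branching_kernels_mult:
  assumes K: "branching_kernels K" and st: "0 \<le> s" "s \<le> t"
  shows "pmf_mean (K s t (enat n)) = of_nat n * pmf_mean (K s t 1)"
proof (induction n)
  case 0
  have "K s t 0 = return_pmf 0" using K st by (simp add: branching_kernels_def)
  then show ?case by (simp add: pmf_mean_def zero_enat_def[symmetric])
next
  case (Suc n)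
  have "K s t (enat n + 1) = map_pmf (\<lambda>(a,b). a + b) (pair_pmf (K s t (enat n)) (K s t 1))"
    using K st unfolding branching_kernels_def by blast
  moreover have "enat (Suc n) = enat n + 1" by (simp add: one_enat_def)
  ultimately have "pmf_mean (K s t (enat (Suc n))) = pmf_mean (K s t (enat n)) + pmf_mean (K s t 1)"
    by (simp add: pmf_mean_def nn_integral_pair_pmf' nn_integral_add case_prod_beta measure_pmf.emeasure_space_1)
  then show ?case using Suc by (simp add: algebra_simps)
qed

text \<open>The mean from time 0 is the average of the means from time \<open>s\<close> over the
  state at time \<open>s\<close>, so every state \<open>m\<close> of positive probability has a
  finite mean. One such \<open>m\<close> is nonzero; it cannot be infinite, as infinity is
  absorbing, and for finite \<open>m\<close> the mean is \<open>m\<close> times that of a single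
  individual.\<close>

lemma pmf_mean_branching_kernels_shift:
  assumes K: "branching_kernels K" and st: "0 \<le> s" "s \<le> t"
    and nz: "pmf (K 0 s 1) 0 < 1" and fin: "pmf_mean (K 0 t 1) < \<infinity>"
  shows "pmf_mean (K s t 1) < \<infinity>"
proof -
  have "K 0 s 1 \<noteq> return_pmf 0" using nz by auto
  then obtain m where m: "m \<in> set_pmf (K 0 s 1)" "m \<noteq> 0"
    by (metis set_pmf_not_empty set_pmf_subset_singleton subsetI singletonD singletonI)
  have "K 0 t 1 = bind_pmf (K 0 s 1) (\<lambda>m. K s t m)"
    using K st unfolding branching_kernels_def by blast
  then have eq: "pmf_mean (K 0 t 1) = (\<integral>\<^sup>+ m. pmf_mean (K s t m) \<partial>measure_pmf (K 0 s 1))"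
    by (simp add: pmf_mean_def)
  have "ennreal (pmf (K 0 s 1) m) * pmf_mean (K s t m) =
     (\<integral>\<^sup>+ x. pmf_mean (K s t m) * indicator {m} x \<partial>measure_pmf (K 0 s 1))"
    by (subst nn_integral_cmult_indicator) (auto simp: emeasure_pmf_single mult.commute)
  also have "\<dots> \<le> pmf_mean (K 0 t 1)"
    unfolding eq by (intro nn_integral_mono) (auto simp: indicator_def)
  finally have "ennreal (pmf (K 0 s 1) m) * pmf_mean (K s t m) < \<infinity>" using fin by (rule le_less_trans)
  moreover have "pmf (K 0 s 1) m > 0" using m by (simp add: pmf_positive)
  ultimately have fin_m: "pmf_mean (K s t m) < \<infinity>"
    by (auto simp: ennreal_mult_less_top)
  show ?thesis
  proof (cases m)
    case (enat k)
    then have "of_nat k * pmf_mean (K s t 1) < \<infinity>"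
      using fin_m pmf_mean_branching_kernels_mult[OF K st, of k] by simp
    then show ?thesis using enat m(2) by (auto simp: ennreal_mult_less_top zero_enat_def)
  next
    case infinity
    have "K s t \<infinity> = return_pmf \<infinity>" using K st by (simp add: branching_kernels_def)
    then have "pmf_mean (K s t m) = \<infinity>" using infinity by (simp add: pmf_mean_def)
    then show ?thesis using fin_m by simp
  qed
qed

text \<open>The two limits separate the two causes of an infinite mean: the value at 1 detects mass
  at infinity, the derivative a divergent first moment.\<close>

lemma pmf_mean_finite_iff_pgf:
  "pmf_mean (K s t 1) < \<infinity> \<longleftrightarrow>
     ((\<lambda>x. pgf K s t (complex_of_real x)) \<longlongrightarrow> 1) (at_left 1) \<and>
     (\<exists>L. ((\<lambda>x. deriv (pgf K s t) (complex_of_real x)) \<longlongrightarrow> L) (at_left 1))"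
proof -
  let ?p = "\<lambda>n. pmf (K s t 1) (enat n)"
  have p: "\<And>n. 0 \<le> ?p n" "summable ?p" and sum: "suminf ?p = 1 - pmf (K s t 1) \<infinity>"
    using pmf_enat_sums[of "K s t 1"] by (auto simp: sums_iff)
  have pgf: "pgf K s t = (\<lambda>z. \<Sum>n. complex_of_real (?p n) * z ^ n)"
    by (simp add: pgf_def fun_eq_iff)
  have ev: "eventually (\<lambda>x. complex_of_real (\<Sum>n. ?p n * x ^ n) = pgf K s t (complex_of_real x)) (at_left 1)"
    using eventually_at_left_real[OF zero_less_one]
    by eventually_elim (auto simp: pgf powser_complex_of_real summable_powser_nonneg_real[OF p])
  have "((\<lambda>x. complex_of_real (\<Sum>n. ?p n * x ^ n)) \<longlongrightarrow> complex_of_real (suminf ?p)) (at_left 1)"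
    by (intro tendsto_of_real powser_tendsto_suminf p)
  then have "((\<lambda>x. pgf K s t (complex_of_real x)) \<longlongrightarrow> complex_of_real (suminf ?p)) (at_left 1)"
    by (rule Lim_transform_eventually[OF _ ev])
  then have "((\<lambda>x. pgf K s t (complex_of_real x)) \<longlongrightarrow> 1) (at_left 1) \<longleftrightarrow> complex_of_real (suminf ?p) = 1"
    using tendsto_unique[OF trivial_limit_at_left_real] by fastforce
  also have "\<dots> \<longleftrightarrow> pmf (K s t 1) \<infinity> = 0" unfolding sum by simp
  finally have lim1: "((\<lambda>x. pgf K s t (complex_of_real x)) \<longlongrightarrow> 1) (at_left 1) \<longleftrightarrow> pmf (K s t 1) \<infinity> = 0" .
  have "(\<exists>L. ((\<lambda>x. deriv (pgf K s t) (complex_of_real x)) \<longlongrightarrow> L) (at_left 1))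
      \<longleftrightarrow> summable (\<lambda>n. real n * ?p n)"
    (is "(\<exists>L. ?lim L) \<longleftrightarrow> _")
  proof
    assume "\<exists>L. ?lim L"
    then obtain L where "?lim L" by blast
    then show "summable (\<lambda>n. real n * ?p n)" unfolding pgf by (rule deriv_powser_tendsto(2)[OF p])
  next
    assume "summable (\<lambda>n. real n * ?p n)"
    from deriv_powser_tendsto(1)[OF p this] show "\<exists>L. ?lim L" unfolding pgf by (rule exI)
  qed
  with lim1 show ?thesis by (simp only: pmf_mean_finite_iff)
qed

text \<open>\<open>Lim\<close> denotes some value even where no limit exists, so
  \<open>bval1\<close> is evaluated only through a limit established beforehand.\<close>

lemma bval1_eqI:
  "((\<lambda>x. f (complex_of_real x)) \<longlongrightarrow> L) (at_left 1) \<Longrightarrow> bval1 f = L"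
  unfolding bval1_def by (rule tendsto_Lim[OF trivial_limit_at_left_real])

lemma bval1_deriv_pgf:
  assumes "pmf_mean (K s t 1) < \<infinity>"
  shows "bval1 (deriv (pgf K s t)) = complex_of_real (enn2real (pmf_mean (K s t 1)))"
proof (rule bval1_eqI)
  let ?p = "\<lambda>n. pmf (K s t 1) (enat n)"
  have p: "\<And>n. 0 \<le> ?p n" "summable ?p"
    using pmf_enat_sums[of "K s t 1"] by (auto simp: sums_iff)
  have s: "summable (\<lambda>n. real n * ?p n)" using assms by (simp only: pmf_mean_finite_iff)
  have "enn2real (pmf_mean (K s t 1)) = (\<Sum>n. real n * ?p n)"
    using pmf_mean_eq[OF assms] s by (simp add: suminf_nonneg)
  moreover have "pgf K s t = (\<lambda>z. \<Sum>n. complex_of_real (?p n) * z ^ n)"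
    by (simp add: pgf_def fun_eq_iff)
  ultimately show "((\<lambda>x. deriv (pgf K s t) (complex_of_real x))
     \<longlongrightarrow> complex_of_real (enn2real (pmf_mean (K s t 1)))) (at_left 1)"
    using deriv_powser_tendsto(1)[OF p s] by (simp only:)
qed

section \<open>The evolution equation on the real interval\<close>

text \<open>A bridge from almost-everywhere statements for \<open>lborel\<close> to the exceptional
  sets of the gauge integral.\<close>

lemma AE_lborel_negligibleE:
  assumes "AE x in lborel. Q x"
  obtains S where "negligible S" "\<And>x. x \<notin> S \<Longrightarrow> Q x"
proof -
  obtain S where S: "S \<in> null_sets lborel" "{x \<in> space lborel. \<not> Q x} \<subseteq> S"
    using assms unfolding eventually_ae_filter by blast
  show thesis
    by (rule that[of S]) (use S in \<open>auto simp: negligible_iff_null_sets intro: null_sets_completionI\<close>)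
qed

lemma AE_nonnegI:
  assumes "\<And>k::nat. AE t in lborel. t \<in> {0..real k} \<longrightarrow> Q t"
  shows "AE t in lborel. 0 \<le> t \<longrightarrow> Q t"
proof -
  have "AE t in lborel. \<forall>k::nat. t \<in> {0..real k} \<longrightarrow> Q t"
    unfolding AE_all_countable using assms by blast
  then show ?thesis
    by eventually_elim (metis atLeastAtMost_iff real_arch_simple)
qed

lemma L1_loc_integrable_on:
  assumes "L1_loc g" "0 \<le> a"
  shows "set_integrable lborel {a..b} g" "g integrable_on {a..b}"
    "(LINT r:{a..b}|lborel. g r) = integral {a..b} g"
proof -
  show "set_integrable lborel {a..b} g"
    by (rule set_integrable_subset[of lborel "{0..b}"]) (use assms in \<open>auto simp: L1_loc_def\<close>)
  from set_borel_integral_eq_integral[OF this]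
  show "g integrable_on {a..b}" "(LINT r:{a..b}|lborel. g r) = integral {a..b} g" by auto
qed

section \<open>The generating function as a function on the real unit interval\<close>

definition rpgf :: "(real \<Rightarrow> real \<Rightarrow> enat \<Rightarrow> enat pmf) \<Rightarrow> real \<Rightarrow> real \<Rightarrow> real \<Rightarrow> real" where
  "rpgf K s t x = (\<Sum>n. pmf (K s t 1) (enat n) * x ^ n)"

lemma pgf_summable:
  "summable (\<lambda>n. pmf (K s t 1) (enat n))" "(\<Sum>n. pmf (K s t 1) (enat n)) = 1 - pmf (K s t 1) \<infinity>"
  "0 \<le> x \<Longrightarrow> x \<le> 1 \<Longrightarrow> summable (\<lambda>n. pmf (K s t 1) (enat n) * x ^ n)"
  using pmf_enat_sums[of "K s t 1"]
  by (auto simp: sums_iff intro!: summable_powser_nonneg_real)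

lemma pgf_of_real:
  "0 \<le> x \<Longrightarrow> x \<le> 1 \<Longrightarrow> pgf K s t (complex_of_real x) = complex_of_real (rpgf K s t x)"
  unfolding pgf_def rpgf_def by (intro powser_complex_of_real pgf_summable)

lemma rpgf_nonneg: "0 \<le> x \<Longrightarrow> x \<le> 1 \<Longrightarrow> 0 \<le> rpgf K s t x"
  unfolding rpgf_def by (intro suminf_nonneg pgf_summable) auto

lemma rpgf_mono: "0 \<le> x \<Longrightarrow> x \<le> y \<Longrightarrow> y \<le> 1 \<Longrightarrow> rpgf K s t x \<le> rpgf K s t y"
  unfolding rpgf_def by (intro suminf_le pgf_summable mult_left_mono power_mono) auto

text \<open>Comparing values at \<open>0\<close> and \<open>1/2\<close> controls \<open>1 - p\<^sub>1\<close>, and hence the distance of the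
  generating function from the identity on the whole unit interval.\<close>

lemma rpgf_minus_id_le:
  assumes w: "0 \<le> w" "w \<le> 1"
  shows "\<bar>rpgf K s t w - w\<bar> \<le> 4 * (\<bar>rpgf K s t (1/2) - 1/2\<bar> + rpgf K s t 0)"
proof -
  define p where "p = (\<lambda>n. pmf (K s t 1) (enat n))"
  have p0: "0 \<le> p n" for n by (simp add: p_def)
  have sp: "p sums (1 - pmf (K s t 1) \<infinity>)" unfolding p_def by (rule pmf_enat_sums)
  define S where "S = 1 - pmf (K s t 1) \<infinity>"
  have S: "p sums S" "S \<le> 1" using sp by (auto simp: S_def)
  have r: "(\<lambda>n. p n * x ^ n) sums rpgf K s t x" if "0 \<le> x" "x \<le> 1" for x
    using pgf_summable(3)[OF that, of K s t] by (simp add: rpgf_def p_def summable_sums)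
  have at0: "rpgf K s t 0 = p 0" by (simp add: rpgf_def p_def)
  have "(\<lambda>n. p n + (if n = 1 then p 1 * w - p 1 else 0)) sums (S + (p 1 * w - p 1))"
    by (intro sums_add S(1) sums_single)
  moreover have "p n * w ^ n \<le> p n + (if n = 1 then p 1 * w - p 1 else 0)" for n
    using p0[of n] w by (auto intro!: mult_left_le power_le_one)
  \<comment> \<open>All coefficients except that of index 1 are bounded by replacing
    \<open>w ^ n\<close> with 1; the lower bound below keeps index 1 alone.\<close>
  ultimately have up: "rpgf K s t w \<le> S + (p 1 * w - p 1)"
    by (rule sums_le[OF _ r[OF w], rotated])
  have "(\<lambda>n. if n = 1 then p 1 * w else 0) sums (p 1 * w)" by (rule sums_single)
  moreover have "(if n = 1 then p 1 * w else 0) \<le> p n * w ^ n" for n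
    using p0[of n] w by auto
  ultimately have lo: "p 1 * w \<le> rpgf K s t w"
    by (rule sums_le[OF _ _ r[OF w], rotated])
  \<comment> \<open>For \<open>n \<ge> 2\<close> the power is at most 1/4. The corrections 3/4 and
    1/4 restore the true values 1 and 1/2 at the indices 0 and 1.\<close>
  have "(\<lambda>n. p n / 4 + (if n = 0 then 3 / 4 * p 0 else 0) + (if n = 1 then p 1 / 4 else 0)) sums
       (S / 4 + 3 / 4 * p 0 + p 1 / 4)"
    by (intro sums_add sums_divide S(1) sums_single)
  moreover have "p n * (1/2) ^ n \<le> p n / 4 + (if n = 0 then 3 / 4 * p 0 else 0) + (if n = 1 then p 1 / 4 else 0)" for n
  proof (cases "n \<le> 1")
    case True then show ?thesis by (cases n) auto
  next
    case False
    then have "(1/2::real) ^ n \<le> (1/2) ^ 2" by (intro power_decreasing) auto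
    from mult_left_mono[OF this p0[of n]] show ?thesis using False by (simp add: power2_eq_square)
  qed
  ultimately have half: "rpgf K s t (1/2) \<le> S / 4 + 3 / 4 * p 0 + p 1 / 4"
    by (rule sums_le[OF _ r, rotated 3]) auto
  \<comment> \<open>Since \<open>S \<le> 1\<close>, the previous bound gives
    \<open>1 - p 1 \<le> 4 * (1/2 - rpgf K s t (1/2)) + 3 * p 0\<close>; this is the origin of the
    factor 4.\<close>
  have p1: "1 - p 1 \<le> 4 * (\<bar>rpgf K s t (1/2) - 1/2\<bar> + rpgf K s t 0)"
    using half S(2) p0[of 0] at0 by argo
  have "p 1 \<le> 1" by (simp add: p_def pmf_le_1)
  then have "(1 - p 1) * w \<le> 1 - p 1" "0 \<le> (1 - p 1) * w"
    using w by (auto intro: mult_left_le)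
  then have "\<bar>rpgf K s t w - w\<bar> \<le> 1 - p 1" using up lo S(2) by (simp add: algebra_simps abs_le_iff)
  with p1 show ?thesis by linarith
qed

text \<open>Silencing index 1 lets every series run over all natural numbers.\<close>

definition branch_rate :: "(real \<Rightarrow> nat \<Rightarrow> real) \<Rightarrow> real \<Rightarrow> nat \<Rightarrow> real" where
  "branch_rate \<alpha> t n = (if n = 1 then 0 else \<alpha> t n)"

section \<open>The flow property and absolute continuity in the earlier time\<close>

locale branching_evolution =
  fixes K :: "real \<Rightarrow> real \<Rightarrow> enat \<Rightarrow> enat pmf"
    and q :: "real \<Rightarrow> real" and \<alpha> :: "real \<Rightarrow> nat \<Rightarrow> real"
  assumes ef: "ac_reverse_evolution_family (pgf K)"
    and gf: "generating_family q \<alpha>"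
    and hvf: "\<forall>t z. 0 \<le> t \<and> z \<in> ball 0 1 \<longrightarrow>
       (AE s in lborel. s \<in> {0..t} \<longrightarrow>
          ((\<lambda>s'. pgf K s' t z) has_vector_derivative herglotz q \<alpha> (pgf K s t z) s) (at s within {0..t}))"
begin

lemmas pgf_refl = ef[unfolded ac_reverse_evolution_family_def, THEN conjunct2, THEN conjunct1, rule_format]

lemmas pgf_comp =
  ef[unfolded ac_reverse_evolution_family_def, THEN conjunct2, THEN conjunct2, THEN conjunct1, rule_format]

lemmas pgf_absolutely_continuous =
  ef[unfolded ac_reverse_evolution_family_def, THEN conjunct2, THEN conjunct2, THEN conjunct2, rule_format]

lemma rpgf_less_1:
  assumes "0 \<le> s" "s \<le> t" "0 \<le> x" "x < 1"
  shows "rpgf K s t x < 1"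
proof -
  have "complex_of_real x \<in> ball 0 1" using assms by simp
  moreover have "pgf K s t ` ball 0 1 \<subseteq> ball 0 1"
    using ef assms by (simp add: ac_reverse_evolution_family_def)
  ultimately have "pgf K s t (complex_of_real x) \<in> ball 0 1" by blast
  then show ?thesis
    using assms rpgf_nonneg[of x K s t] by (simp add: pgf_of_real)
qed

lemma rpgf_refl:
  assumes "0 \<le> s" "0 \<le> x" "x < 1"
  shows "rpgf K s s x = x"
proof -
  have "complex_of_real x \<in> ball 0 1" using assms by simp
  then have "pgf K s s (complex_of_real x) = complex_of_real x"
    using assms by (intro pgf_refl) auto
  then show ?thesis using assms by (simp add: pgf_of_real)
qed

lemma rpgf_comp:
  assumes "0 \<le> s" "s \<le> t" "t \<le> u" "0 \<le> x" "x < 1"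
  shows "rpgf K s u x = rpgf K s t (rpgf K t u x)"
proof -
  have "complex_of_real x \<in> ball 0 1" using assms by simp
  then have "pgf K s u (complex_of_real x) = pgf K s t (pgf K t u (complex_of_real x))"
    using assms by (intro pgf_comp) auto
  moreover have "0 \<le> rpgf K t u x" "rpgf K t u x \<le> 1"
    using assms rpgf_nonneg[of x K t u] rpgf_less_1[of t u x] by auto
  ultimately show ?thesis using assms by (simp add: pgf_of_real)
qed

text \<open>With \<open>w = rpgf K b t x\<close> the increment equals
  \<open>rpgf K a b w - w\<close> up to sign. Here \<open>w\<close> varies with \<open>b\<close>,
  \<open>t\<close> and \<open>x\<close>, but \<open>rpgf_minus_id_le\<close> replaces it by the
  fixed points 0 and 1/2. A single \<open>g\<close>, built from the dominating functions at these
  two points, therefore serves all \<open>x\<close> and \<open>t\<close>.\<close>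

lemma rpgf_absolutely_continuous:
  obtains g where "L1_loc g"
    "\<And>a b t x. 0 \<le> a \<Longrightarrow> a \<le> b \<Longrightarrow> b \<le> t \<Longrightarrow> 0 \<le> x \<Longrightarrow> x < 1 \<Longrightarrow>
       \<bar>rpgf K b t x - rpgf K a t x\<bar> \<le> integral {a..b} g"
proof -
  have "\<forall>x. \<exists>f. 0 \<le> x \<and> x < 1 \<longrightarrow> L1_loc f \<and>
        (\<forall>a b. 0 \<le> a \<and> a \<le> b \<longrightarrow> \<bar>rpgf K a b x - x\<bar> \<le> integral {a..b} f)"
  proof
    fix x :: real
    show "\<exists>f. 0 \<le> x \<and> x < 1 \<longrightarrow> L1_loc f \<and>
        (\<forall>a b. 0 \<le> a \<and> a \<le> b \<longrightarrow> \<bar>rpgf K a b x - x\<bar> \<le> integral {a..b} f)"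
    proof (cases "0 \<le> x \<and> x < 1")
      case x: True
      then have "complex_of_real x \<in> ball 0 1" by simp
      from pgf_absolutely_continuous[OF this] obtain f where f: "L1_loc f" "\<And>s t u. 0 \<le> s \<and> s \<le> t \<and> t \<le> u \<Longrightarrow>
           cmod (pgf K s u (complex_of_real x) - pgf K s t (complex_of_real x)) \<le> (LINT r:{t..u}|lborel. f r)"
        by blast
      \<comment> \<open>The hypothesis is used with its first two times equal, where the generating
        function is the identity.\<close>
      have "\<bar>rpgf K a b x - x\<bar> \<le> integral {a..b} f" if "0 \<le> a" "a \<le> b" for a b
        using f(2)[of a a b] that x L1_loc_integrable_on(3)[OF f(1) that(1), of b]
        by (simp add: pgf_of_real rpgf_refl flip: of_real_diff)
      with f(1) show ?thesis by blast
    qed auto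
  qed
  then obtain f where f: "\<And>x. 0 \<le> x \<Longrightarrow> x < 1 \<Longrightarrow> L1_loc (f x)"
    "\<And>x a b. 0 \<le> x \<Longrightarrow> x < 1 \<Longrightarrow> 0 \<le> a \<Longrightarrow> a \<le> b \<Longrightarrow> \<bar>rpgf K a b x - x\<bar> \<le> integral {a..b} (f x)"
    by metis
  define g where "g = (\<lambda>r. 4 * (f (1/2) r + f 0 r))"
  have "L1_loc g" using f(1)[of 0] f(1)[of "1/2"] unfolding L1_loc_def g_def
    by (auto intro!: set_integral_mult_right set_integral_add)
  moreover have "\<bar>rpgf K b t x - rpgf K a t x\<bar> \<le> integral {a..b} g"
    if h: "0 \<le> a" "a \<le> b" "b \<le> t" "0 \<le> x" "x < 1" for a b t x
  proof -
    have "\<bar>rpgf K b t x - rpgf K a t x\<bar> = \<bar>rpgf K a b (rpgf K b t x) - rpgf K b t x\<bar>"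
      using rpgf_comp[OF h] by (simp add: abs_minus_commute)
    also have "\<dots> \<le> 4 * (\<bar>rpgf K a b (1/2) - 1/2\<bar> + rpgf K a b 0)"
      by (rule rpgf_minus_id_le) (use h rpgf_nonneg[of x K b t] rpgf_less_1[of b t x] in auto)
    also have "\<dots> \<le> 4 * (integral {a..b} (f (1/2)) + integral {a..b} (f 0))"
    proof -
      have "\<bar>rpgf K a b (1/2) - 1/2\<bar> \<le> integral {a..b} (f (1/2))" by (rule f(2)) (use h in auto)
      moreover have "\<bar>rpgf K a b 0 - 0\<bar> \<le> integral {a..b} (f 0)" by (rule f(2)) (use h in auto)
      then have "rpgf K a b 0 \<le> integral {a..b} (f 0)" by simp
      ultimately show ?thesis by (intro mult_left_mono add_mono) auto
    qed
    also have "\<dots> = integral {a..b} g"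
      unfolding g_def using L1_loc_integrable_on(2)[OF f(1) h(1), of 0 b] L1_loc_integrable_on(2)[OF f(1) h(1), of "1/2" b]
      by (simp add: integral_add)
    finally show ?thesis .
  qed
  ultimately show thesis by (rule that)
qed

section \<open>The vector field expressed through the branching rates\<close>

lemma AE_summable_branch_rate: "AE t in lborel. 0 \<le> t \<longrightarrow> summable (branch_rate \<alpha> t)"
proof -
  have [measurable]: "(\<lambda>t. \<alpha> t n) \<in> borel_measurable lborel" for n
    using gf by (simp add: generating_family_def)
  show ?thesis
  proof (rule AE_nonnegI)
    fix k :: nat
    have "(\<integral>\<^sup>+ t. indicator {0..real k} t * (\<Sum>n. ennreal (if n = 1 then 0 else \<alpha> t n)) \<partial>lborel) \<noteq> \<infinity>"
      using gf unfolding generating_family_def by (auto simp: less_top)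
    then have "AE t in lborel. indicator {0..real k} t * (\<Sum>n. ennreal (if n = 1 then 0 else \<alpha> t n)) \<noteq> \<infinity>"
      by (intro nn_integral_noteq_infinite) auto
    then show "AE t in lborel. t \<in> {0..real k} \<longrightarrow> summable (branch_rate \<alpha> t)"
    proof eventually_elim
      case (elim t)
      show ?case
      proof
        assume t: "t \<in> {0..real k}"
        then have "\<And>n. 0 \<le> branch_rate \<alpha> t n" using gf by (auto simp: branch_rate_def generating_family_def)
        then show "summable (branch_rate \<alpha> t)"
          by (rule summable_suminf_not_top) (use elim t in \<open>auto simp: branch_rate_def\<close>)
      qed
    qed
  qed
qed

lemma branch_rate_nonneg: "0 \<le> t \<Longrightarrow> 0 \<le> branch_rate \<alpha> t n"
  using gf by (auto simp: branch_rate_def generating_family_def)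

lemma q_nonneg: "0 \<le> t \<Longrightarrow> 0 \<le> q t"
  using gf by (auto simp: generating_family_def)

lemma herglotz_eq:
  assumes "0 \<le> t" "summable (branch_rate \<alpha> t)" "norm z < 1"
  shows "herglotz q \<alpha> z t = of_real (q t + suminf (branch_rate \<alpha> t)) * z
            - (\<Sum>n. of_real (branch_rate \<alpha> t n) * z ^ n)"
proof -
  have "(\<lambda>n. of_real (branch_rate \<alpha> t n) * z - of_real (branch_rate \<alpha> t n) * z ^ n) sums
      (of_real (suminf (branch_rate \<alpha> t)) * z - (\<Sum>n. of_real (branch_rate \<alpha> t n) * z ^ n))"
    using assms branch_rate_nonneg
    by (intro sums_diff sums_mult2 sums_of_real summable_sums summable_powser_nonneg) auto
  moreover have "(if n = 1 then 0 else of_real (\<alpha> t n) * (z - z ^ n))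
     = of_real (branch_rate \<alpha> t n) * z - of_real (branch_rate \<alpha> t n) * z ^ n" for n
    by (simp add: branch_rate_def algebra_simps)
  ultimately have "(\<Sum>n. if n = 1 then 0 else of_real (\<alpha> t n) * (z - z ^ n))
    = of_real (suminf (branch_rate \<alpha> t)) * z - (\<Sum>n. of_real (branch_rate \<alpha> t n) * z ^ n)"
    by (simp only: sums_iff)
  then show ?thesis unfolding herglotz_def by (simp only: of_real_add distrib_right add_diff_eq)
qed

text \<open>\<open>rate r y\<close> is \<open>\<Phi>(y, r) / (1 - y) + \<alpha>\<^sub>r(0)\<close>, set to zero where the series defining \<open>\<Phi>\<close> need not converge.\<close>

definition rate :: "real \<Rightarrow> real \<Rightarrow> real" where
  "rate r y = (if summable (branch_rate \<alpha> r)
     then q r * (y / (1 - y)) + (\<Sum>n. branch_rate \<alpha> r n * (\<Sum>j\<in>{1..<n}. y ^ j)) else 0)"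

lemma summable_rate:
  assumes "0 \<le> r" "summable (branch_rate \<alpha> r)" "0 \<le> y" "y < 1"
  shows "summable (\<lambda>n. branch_rate \<alpha> r n * (\<Sum>j\<in>{1..<n}. y ^ j))"
proof (rule summable_comparison_test'[of "\<lambda>n. branch_rate \<alpha> r n * (1 / (1 - y))" 0])
  show "summable (\<lambda>n. branch_rate \<alpha> r n * (1 / (1 - y)))"
    using assms(2) by (rule summable_mult2)
  fix n
  have "(\<Sum>j\<in>{1..<n}. y ^ j) \<le> (\<Sum>j<n. y ^ j)"
    using assms by (intro sum_mono2) auto
  also have "\<dots> \<le> 1 / (1 - y)"
    using assms by (simp add: sum_gp_strict divide_right_mono)
  finally have "branch_rate \<alpha> r n * (\<Sum>j\<in>{1..<n}. y ^ j) \<le> branch_rate \<alpha> r n * (1 / (1 - y))"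
    using assms branch_rate_nonneg[of r n] by (intro mult_left_mono) auto
  then show "norm (branch_rate \<alpha> r n * (\<Sum>j\<in>{1..<n}. y ^ j)) \<le> branch_rate \<alpha> r n * (1 / (1 - y))"
    using assms branch_rate_nonneg[of r n] by (simp add: abs_mult sum_nonneg)
qed

text \<open>For \<open>n \<ge> 1\<close> the term \<open>y - y ^ n\<close> is \<open>1 - y\<close>
  times the sum of \<open>y ^ j\<close> over \<open>{1..<n}\<close>. At \<open>n = 0\<close> that
  sum is empty although \<open>y - 1 = - (1 - y)\<close>, so \<alpha>(0) has to be subtracted
  separately.\<close>

lemma herglotz_rate:
  assumes r: "0 \<le> r" "summable (branch_rate \<alpha> r)" and y: "0 \<le> y" "y < 1"
  shows "herglotz q \<alpha> (complex_of_real y) r = complex_of_real ((rate r y - \<alpha> r 0) * (1 - y))"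
proof -
  let ?a = "branch_rate \<alpha> r"
  have "(\<lambda>n. ?a n * (\<Sum>j\<in>{1..<n}. y ^ j) - (if n = 0 then \<alpha> r 0 else 0)) sums
     ((\<Sum>n. ?a n * (\<Sum>j\<in>{1..<n}. y ^ j)) - \<alpha> r 0)"
    by (intro sums_diff summable_sums summable_rate r y sums_single)
  then have "(\<lambda>n. (?a n * (\<Sum>j\<in>{1..<n}. y ^ j) - (if n = 0 then \<alpha> r 0 else 0)) * (1 - y)) sums
     (((\<Sum>n. ?a n * (\<Sum>j\<in>{1..<n}. y ^ j)) - \<alpha> r 0) * (1 - y))"
    by (rule sums_mult2)
  moreover have "(?a n * (\<Sum>j\<in>{1..<n}. y ^ j) - (if n = 0 then \<alpha> r 0 else 0)) * (1 - y)
      = ?a n * y - ?a n * y ^ n" for n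
  proof (cases n)
    case 0 then show ?thesis by (simp add: branch_rate_def algebra_simps)
  next
    case (Suc m)
    have "{..<n} = insert 0 {1..<n}" using Suc by auto
    then have "(\<Sum>j\<in>{1..<n}. y ^ j) = (\<Sum>j<n. y ^ j) - 1" by simp
    then have "(\<Sum>j\<in>{1..<n}. y ^ j) * (1 - y) = y - y ^ n"
      using y by (simp add: sum_gp_strict field_simps)
    then have "?a n * ((\<Sum>j\<in>{1..<n}. y ^ j) * (1 - y)) = ?a n * (y - y ^ n)" by simp
    then show ?thesis using Suc by (simp only: mult.assoc right_diff_distrib) simp
  qed
  ultimately have s1: "(\<lambda>n. ?a n * y - ?a n * y ^ n) sums
     (((\<Sum>n. ?a n * (\<Sum>j\<in>{1..<n}. y ^ j)) - \<alpha> r 0) * (1 - y))" by simp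
  have sy: "summable (\<lambda>n. ?a n * y ^ n)"
    using r y branch_rate_nonneg by (intro summable_powser_nonneg_real) auto
  then have s2: "(\<lambda>n. ?a n * y - ?a n * y ^ n) sums (suminf ?a * y - (\<Sum>n. ?a n * y ^ n))"
    by (intro sums_diff sums_mult2 summable_sums r)
  have eq: "suminf ?a * y - (\<Sum>n. ?a n * y ^ n)
      = ((\<Sum>n. ?a n * (\<Sum>j\<in>{1..<n}. y ^ j)) - \<alpha> r 0) * (1 - y)" by (rule sums_unique2[OF s2 s1])
  have "herglotz q \<alpha> (complex_of_real y) r
     = complex_of_real (q r * y + (suminf ?a * y - (\<Sum>n. ?a n * y ^ n)))"
    using r y by (simp add: herglotz_eq powser_complex_of_real[OF sy] distrib_right)
  also have "q r * y + (suminf ?a * y - (\<Sum>n. ?a n * y ^ n)) = (rate r y - \<alpha> r 0) * (1 - y)"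
    unfolding eq rate_def using r y by (simp add: field_simps)
  finally show ?thesis .
qed

section \<open>The differential equation and its logarithmic integral\<close>

lemma rpgf_ode:
  assumes t: "0 \<le> t" and x: "0 \<le> x" "x < 1"
  shows "AE r in lborel. r \<in> {0..t} \<longrightarrow> ((\<lambda>r. rpgf K r t x) has_real_derivative
           (rate r (rpgf K r t x) - \<alpha> r 0) * (1 - rpgf K r t x)) (at r within {0..t})"
proof -
  have "complex_of_real x \<in> ball 0 1" using x by simp
  with hvf t have "AE s in lborel. s \<in> {0..t} \<longrightarrow>
          ((\<lambda>s'. pgf K s' t (complex_of_real x)) has_vector_derivative
             herglotz q \<alpha> (pgf K s t (complex_of_real x)) s) (at s within {0..t})"
    by blast
  with AE_summable_branch_rate show ?thesis
  proof eventually_elim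
    case (elim r)
    show ?case
    proof
      assume r: "r \<in> {0..t}"
      let ?y = "rpgf K r t x"
      have y: "0 \<le> ?y" "?y < 1" using r x rpgf_nonneg[of x K r t] rpgf_less_1[of r t x] by auto
      have pgf: "pgf K s t (complex_of_real x) = complex_of_real (rpgf K s t x)" for s
        using x by (simp add: pgf_of_real)
      have "((\<lambda>s'. complex_of_real (rpgf K s' t x)) has_vector_derivative
             complex_of_real ((rate r ?y - \<alpha> r 0) * (1 - ?y))) (at r within {0..t})"
        using elim r y by (simp add: pgf herglotz_rate del: of_real_mult of_real_diff)
      from bounded_linear.has_vector_derivative[OF bounded_linear_Re this]
      show "((\<lambda>r. rpgf K r t x) has_real_derivative (rate r ?y - \<alpha> r 0) * (1 - ?y)) (at r within {0..t})"
        by (simp add: has_real_derivative_iff_has_vector_derivative)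
    qed
  qed
qed

text \<open>The logarithm of \<open>1 - u\<close> inherits absolute continuity only if
  \<open>u\<close> stays away from 1 on the whole interval. Domination by an indefinite integral
  makes \<open>u\<close> continuous in the earlier time, so it attains its maximum, and each value
  is below 1.\<close>

lemma rpgf_bounded_away:
  assumes st: "0 \<le> s" "s \<le> t" and x: "0 \<le> x" "x < 1"
  obtains m where "0 < m" "\<And>r. r \<in> {s..t} \<Longrightarrow> m \<le> 1 - rpgf K r t x"
proof -
  obtain g where g: "L1_loc g"
    "\<And>a b t x. 0 \<le> a \<Longrightarrow> a \<le> b \<Longrightarrow> b \<le> t \<Longrightarrow> 0 \<le> x \<Longrightarrow> x < 1 \<Longrightarrow>
       \<bar>rpgf K b t x - rpgf K a t x\<bar> \<le> integral {a..b} g"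
    using rpgf_absolutely_continuous by blast
  have gi: "g integrable_on {s..t}" by (rule L1_loc_integrable_on(2)[OF g(1) st(1)])
  define J where "J = (\<lambda>r. integral {s..r} g)"
  have J: "continuous_on {s..t} J" unfolding J_def by (rule indefinite_integral_continuous_1[OF gi])
  have le: "\<bar>rpgf K b t x - rpgf K a t x\<bar> \<le> \<bar>J b - J a\<bar>" if ab: "a \<in> {s..t}" "b \<in> {s..t}" "a \<le> b" for a b
  proof -
    have "integral {s..a} g + integral {a..b} g = integral {s..b} g"
      by (rule Henstock_Kurzweil_Integration.integral_combine)
         (use ab in \<open>auto intro: integrable_subinterval_real[OF gi]\<close>)
    then have "integral {a..b} g = J b - J a" by (simp add: J_def)
    with g(2)[of a b t x] ab st x show ?thesis by auto
  qed
  have le': "dist (rpgf K a t x) (rpgf K b t x) \<le> dist (J a) (J b)" if "a \<in> {s..t}" "b \<in> {s..t}" for a b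
    using le[of a b] le[of b a] that by (cases "a \<le> b") (auto simp: dist_real_def)
  have "continuous_on {s..t} (\<lambda>r. rpgf K r t x)"
    unfolding continuous_on_iff
  proof safe
    fix r e :: real assume r: "r \<in> {s..t}" and e: "e > 0"
    with J obtain d where "d > 0" and d: "\<forall>r'\<in>{s..t}. dist r' r < d \<longrightarrow> dist (J r') (J r) < e"
      unfolding continuous_on_iff by blast
    then show "\<exists>d>0. \<forall>r'\<in>{s..t}. dist r' r < d \<longrightarrow> dist (rpgf K r' t x) (rpgf K r t x) < e"
      using le'[OF _ r] by (meson le_less_trans)
  qed
  then obtain r0 where r0: "r0 \<in> {s..t}" "\<And>r. r \<in> {s..t} \<Longrightarrow> rpgf K r t x \<le> rpgf K r0 t x"
    using continuous_attains_sup[of "{s..t}" "\<lambda>r. rpgf K r t x"] st by auto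
  show thesis
  proof (rule that)
    show "0 < 1 - rpgf K r0 t x" using rpgf_less_1[of r0 t x] r0 st x by auto
  qed (use r0 in auto)
qed

text \<open>The logarithmic derivative cancels the factor \<open>1 - u\<close> of the vector field,
  leaving \<open>rate r u - \<alpha> r 0\<close>; the boundary value at \<open>r = t\<close> is
  \<open>x\<close> because \<open>rpgf K t t\<close> is the identity.\<close>

lemma rate_has_integral_ln:
  assumes st: "0 \<le> s" "s \<le> t" and x: "0 \<le> x" "x < 1"
  shows "((\<lambda>r. rate r (rpgf K r t x) - \<alpha> r 0) has_integral ln ((1 - rpgf K s t x) / (1 - x))) {s..t}"
proof -
  obtain g where g: "L1_loc g"
    "\<And>a b t x. 0 \<le> a \<Longrightarrow> a \<le> b \<Longrightarrow> b \<le> t \<Longrightarrow> 0 \<le> x \<Longrightarrow> x < 1 \<Longrightarrow>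
       \<bar>rpgf K b t x - rpgf K a t x\<bar> \<le> integral {a..b} g"
    using rpgf_absolutely_continuous by blast
  obtain m where m: "0 < m" "\<And>r. r \<in> {s..t} \<Longrightarrow> m \<le> 1 - rpgf K r t x"
    using rpgf_bounded_away[OF st x] by blast
  have "AE r in lborel. r \<in> {0..t} \<longrightarrow> ((\<lambda>r. rpgf K r t x) has_real_derivative
           (rate r (rpgf K r t x) - \<alpha> r 0) * (1 - rpgf K r t x)) (at r within {0..t})"
    by (rule rpgf_ode) (use st x in auto)
  then obtain S where S: "negligible S" and ode: "\<And>r. r \<notin> S \<Longrightarrow> r \<in> {0..t} \<Longrightarrow> ((\<lambda>r. rpgf K r t x) has_real_derivative
           (rate r (rpgf K r t x) - \<alpha> r 0) * (1 - rpgf K r t x)) (at r within {0..t})"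
    using AE_lborel_negligibleE by blast
  define h where "h = (\<lambda>r. - ln (1 - rpgf K r t x))"
  have "((\<lambda>r. rate r (rpgf K r t x) - \<alpha> r 0) has_integral h t - h s) {s..t}"
  proof (rule has_integral_of_absolutely_continuous[OF st(2) _ _ S])
    \<comment> \<open>On values at least \<open>m\<close> the logarithm has Lipschitz constant
      \<open>1 / m\<close>, so \<open>g / m\<close> dominates the increments of
      \<open>h\<close>.\<close>
    show "(\<lambda>r. g r / m) integrable_on {s..t}"
      using L1_loc_integrable_on(2)[OF g(1) st(1)] by (rule integrable_on_divide)
    fix a b assume ab: "s \<le> a" "a \<le> b" "b \<le> t"
    let ?A = "1 - rpgf K a t x" and ?B = "1 - rpgf K b t x"
    have pos: "m \<le> ?A" "m \<le> ?B" using m(2) ab by auto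
    have "\<bar>rpgf K b t x - rpgf K a t x\<bar> / m \<le> integral {a..b} g / m"
      using g(2)[of a b t x] ab st x m(1) by (intro divide_right_mono) auto
    moreover have "ln ?A - ln ?B \<le> \<bar>rpgf K b t x - rpgf K a t x\<bar> / m"
    proof -
      have "ln ?A - ln ?B \<le> (?A - ?B) / ?B" using pos m(1) by (intro ln_diff_le) auto
      also have "\<dots> \<le> \<bar>rpgf K b t x - rpgf K a t x\<bar> / m"
        using pos m(1) by (intro frac_le) auto
      finally show ?thesis .
    qed
    moreover have "ln ?B - ln ?A \<le> \<bar>rpgf K b t x - rpgf K a t x\<bar> / m"
    proof -
      have "ln ?B - ln ?A \<le> (?B - ?A) / ?A" using pos m(1) by (intro ln_diff_le) auto
      also have "\<dots> \<le> \<bar>rpgf K b t x - rpgf K a t x\<bar> / m"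
        using pos m(1) by (intro frac_le) auto
      finally show ?thesis .
    qed
    ultimately show "\<bar>h b - h a\<bar> \<le> integral {a..b} (\<lambda>r. g r / m)"
      by (simp add: h_def abs_le_iff)
  next
    fix r assume r: "r \<in> {s..t} - S"
    let ?y = "rpgf K r t x"
    have "?y < 1" using m r by fastforce
    have "((\<lambda>r. rpgf K r t x) has_real_derivative (rate r ?y - \<alpha> r 0) * (1 - ?y)) (at r within {s..t})"
      by (rule has_field_derivative_subset[OF ode]) (use r st in auto)
    then have "(h has_real_derivative rate r ?y - \<alpha> r 0) (at r within {s..t})"
      unfolding h_def using \<open>?y < 1\<close>
      by (auto intro!: derivative_eq_intros simp: field_simps)
    then show "(h has_vector_derivative rate r ?y - \<alpha> r 0) (at r within {s..t})"
      by (simp add: has_real_derivative_iff_has_vector_derivative)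
  qed
  moreover have "h t - h s = ln ((1 - rpgf K s t x) / (1 - x))"
    using st x rpgf_refl[of t x] rpgf_less_1[of s t x] by (simp add: h_def ln_div)
  ultimately show ?thesis by simp
qed

lemma alpha_measurable [measurable]: "(\<lambda>t. \<alpha> t n) \<in> borel_measurable borel"
  using gf by (simp add: generating_family_def)

lemma branch_rate_measurable [measurable]: "(\<lambda>t. branch_rate \<alpha> t n) \<in> borel_measurable borel"
  by (simp add: branch_rate_def)

lemma branch_rate_nn_integral_finite:
  "(\<integral>\<^sup>+ t. indicator {0..T} t * (\<Sum>n. ennreal (branch_rate \<alpha> t n)) \<partial>lborel) < \<infinity>"
  using gf by (simp add: generating_family_def branch_rate_def)

text \<open>\<alpha>(0) is one term of the locally integrable total rate. Its integral can thus be
  added to both sides, which leaves the nonnegative integrand \<open>rate\<close>.\<close>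

lemma integrable_alpha_0:
  assumes "0 \<le> s"
  shows "(\<lambda>r. \<alpha> r 0) integrable_on {s..t}" "0 \<le> integral {s..t} (\<lambda>r. \<alpha> r 0)"
proof -
  have "set_integrable lborel {s..t} (\<lambda>r. \<alpha> r 0)"
    unfolding set_integrable_def
  proof (rule integrableI_bounded)
    have "(\<integral>\<^sup>+ r. ennreal (norm (indicat_real {s..t} r *\<^sub>R \<alpha> r 0)) \<partial>lborel)
       \<le> (\<integral>\<^sup>+ r. indicator {0..t} r * (\<Sum>n. ennreal (branch_rate \<alpha> r n)) \<partial>lborel)"
    proof (rule nn_integral_mono)
      fix r
      have "ennreal (branch_rate \<alpha> r 0) \<le> (\<Sum>n. ennreal (branch_rate \<alpha> r n))"
        using sum_le_suminf[of "\<lambda>n. ennreal (branch_rate \<alpha> r n)" "{0}"] by simp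
      then show "ennreal (norm (indicat_real {s..t} r *\<^sub>R \<alpha> r 0))
          \<le> indicator {0..t} r * (\<Sum>n. ennreal (branch_rate \<alpha> r n))"
        using assms branch_rate_nonneg[of r 0] by (auto simp: indicator_def branch_rate_def)
    qed
    also note branch_rate_nn_integral_finite
    finally show "(\<integral>\<^sup>+ r. ennreal (norm (indicat_real {s..t} r *\<^sub>R \<alpha> r 0)) \<partial>lborel) < \<infinity>" .
  qed simp
  from set_borel_integral_eq_integral(1)[OF this]
  show "(\<lambda>r. \<alpha> r 0) integrable_on {s..t}" .
  then show "0 \<le> integral {s..t} (\<lambda>r. \<alpha> r 0)"
    by (rule integral_nonneg) (use assms branch_rate_nonneg[of _ 0] in \<open>auto simp: branch_rate_def\<close>)
qed

subsection \<open>Monotone convergence at the boundary\<close>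

lemma rate_ennreal:
  assumes "0 \<le> r" "summable (branch_rate \<alpha> r)" "0 \<le> y" "y < 1"
  shows "ennreal (rate r y) = ennreal (q r * (y / (1 - y)))
     + (\<Sum>n. ennreal (branch_rate \<alpha> r n * (\<Sum>j\<in>{1..<n}. y ^ j)))"
proof -
  have nn: "0 \<le> branch_rate \<alpha> r n * (\<Sum>j\<in>{1..<n}. y ^ j)" for n
    using assms branch_rate_nonneg by (intro mult_nonneg_nonneg sum_nonneg) auto
  show ?thesis
    using assms q_nonneg[of r] nn summable_rate[OF assms]
    by (simp add: rate_def suminf_ennreal2 suminf_nonneg ennreal_plus)
qed

lemma rate_nonneg:
  assumes "0 \<le> r" "0 \<le> y" "y < 1"
  shows "0 \<le> rate r y"
proof (cases "summable (branch_rate \<alpha> r)")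
  case True
  have "0 \<le> (\<Sum>n. branch_rate \<alpha> r n * (\<Sum>j\<in>{1..<n}. y ^ j))"
    using assms True branch_rate_nonneg
    by (intro suminf_nonneg summable_rate mult_nonneg_nonneg sum_nonneg) auto
  then show ?thesis using assms q_nonneg[of r] True by (simp add: rate_def)
qed (simp add: rate_def)

lemma odds_mono: "0 \<le> y \<Longrightarrow> y \<le> z \<Longrightarrow> z < 1 \<Longrightarrow> y / (1 - y) \<le> z / (1 - z)" for y z :: real
  by (intro frac_le) auto

lemma rate_mono:
  assumes "0 \<le> r" "0 \<le> y" "y \<le> z" "z < 1"
  shows "rate r y \<le> rate r z"
proof (cases "summable (branch_rate \<alpha> r)")
  case True
  have "(\<Sum>n. branch_rate \<alpha> r n * (\<Sum>j\<in>{1..<n}. y ^ j)) \<le> (\<Sum>n. branch_rate \<alpha> r n * (\<Sum>j\<in>{1..<n}. z ^ j))"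
    using assms True branch_rate_nonneg
    by (intro suminf_le summable_rate mult_left_mono sum_mono power_mono) auto
  moreover have "q r * (y / (1 - y)) \<le> q r * (z / (1 - z))"
    using assms q_nonneg[of r] odds_mono[of y z] by (intro mult_left_mono) auto
  ultimately show ?thesis using True by (simp add: rate_def)
qed (simp add: rate_def)

text \<open>The supremum of \<open>rate r\<close> over the unit interval; truncated subtraction makes the term \<open>n = 0\<close> vanish.\<close>

definition rate_sup :: "real \<Rightarrow> ennreal" where
  "rate_sup r = (if q r = 0 then 0 else top) + (\<Sum>n. ennreal (branch_rate \<alpha> r n * real (n - 1)))"

lemma rate_le_rate_sup:
  assumes "0 \<le> r" "summable (branch_rate \<alpha> r)" "0 \<le> y" "y < 1"
  shows "ennreal (rate r y) \<le> rate_sup r"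
proof -
  have "(\<Sum>j\<in>{1..<n}. y ^ j) \<le> real (n - 1)" for n
    using sum_bounded_above[of "{1..<n}" "\<lambda>j. y ^ j" 1] assms by (simp add: power_le_one)
  then show ?thesis
    unfolding rate_ennreal[OF assms] rate_sup_def using assms branch_rate_nonneg
    by (intro add_mono suminf_le ennreal_leI mult_left_mono) auto
qed

text \<open>Both parts increase with \<open>y\<close>, so suprema pass through the sum and the
  series. The inner sums rise to \<open>n - 1\<close>, whereas \<open>y / (1 - y)\<close> is
  unbounded; hence a positive \<open>q r\<close> forces the value \<open>top\<close>.\<close>

lemma SUP_rate:
  assumes r: "0 \<le> r" "summable (branch_rate \<alpha> r)"
    and y: "\<And>k. 0 \<le> y k" "\<And>k. y k < 1" "incseq y" "y \<longlonglongrightarrow> 1"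
  shows "(SUP k. ennreal (rate r (y k))) = rate_sup r"
proof -
  let ?Q = "\<lambda>k. ennreal (q r * (y k / (1 - y k)))"
  let ?T = "\<lambda>k n. ennreal (branch_rate \<alpha> r n * (\<Sum>j\<in>{1..<n}. y k ^ j))"
  have ymono: "y k \<le> y l" if "k \<le> l" for k l using y(3) that by (rule incseqD)
  have incQ: "incseq ?Q"
    using q_nonneg[OF r(1)] odds_mono[OF y(1) ymono y(2)]
    by (intro monoI ennreal_leI mult_left_mono) auto
  have incT: "incseq (\<lambda>k. ?T k n)" for n
    using branch_rate_nonneg[OF r(1)] y(1) ymono
    by (intro monoI ennreal_leI mult_left_mono sum_mono power_mono) auto
  have "(SUP k. ennreal (rate r (y k))) = (SUP k. ?Q k + (\<Sum>n. ?T k n))"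
    using rate_ennreal[OF r y(1,2)] by simp
  also have "\<dots> = (SUP k. ?Q k) + (SUP k. \<Sum>n. ?T k n)"
    using incQ incT by (intro ennreal_SUP_add monoI suminf_le) (auto simp: incseq_def)
  also have "(SUP k. \<Sum>n. ?T k n) = (\<Sum>n. SUP k. ?T k n)"
    by (rule ennreal_suminf_SUP_eq[symmetric]) (rule incT)
  also have "(\<lambda>n. SUP k. ?T k n) = (\<lambda>n. ennreal (branch_rate \<alpha> r n * real (n - 1)))"
  proof (intro ext LIMSEQ_unique[OF LIMSEQ_SUP[OF incT]])
    fix n
    have "(\<lambda>k. branch_rate \<alpha> r n * (\<Sum>j\<in>{1..<n}. y k ^ j)) \<longlonglongrightarrow> branch_rate \<alpha> r n * (\<Sum>j\<in>{1..<n}. 1 ^ j)"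
      by (intro tendsto_intros y)
    then show "(\<lambda>k. ?T k n) \<longlonglongrightarrow> ennreal (branch_rate \<alpha> r n * real (n - 1))"
      by (intro tendsto_ennrealI) simp
  qed
  also have "(SUP k. ?Q k) = (if q r = 0 then 0 else top)"
  proof (cases "q r = 0")
    case False
    then have q: "q r > 0" using q_nonneg[OF r(1)] by simp
    have "LIM k sequentially. y k / (1 - y k) :> at_top"
    proof (rule LIM_at_top_divide[OF y(4)])
      have "(\<lambda>k. 1 - y k) \<longlonglongrightarrow> 1 - 1" by (intro tendsto_intros y)
      then show "(\<lambda>k. 1 - y k) \<longlonglongrightarrow> 0" by simp
    qed (use y(2) in auto)
    then have "LIM k sequentially. q r * (y k / (1 - y k)) :> at_top"
      using q by (intro filterlim_tendsto_pos_mult_at_top[OF tendsto_const])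
    then have "?Q \<longlonglongrightarrow> top" by (simp add: ennreal_tendsto_top_eq_at_top)
    from LIMSEQ_unique[OF LIMSEQ_SUP[OF incQ] this] False show ?thesis by simp
  qed simp
  finally show ?thesis by (simp add: rate_sup_def)
qed

definition rate_sup_integral :: "real \<Rightarrow> real \<Rightarrow> ennreal" where
  "rate_sup_integral s t = (\<integral>\<^sup>+ r. rate_sup r * indicator {s..t} r \<partial>lborel)"

text \<open>Measurability is read off from gauge integrability and is therefore obtained only with
  respect to \<open>lebesgue\<close>.\<close>

lemma rate_nn_integral:
  assumes st: "0 \<le> s" "s \<le> t" and x: "0 \<le> x" "x < 1"
  defines "c \<equiv> ln ((1 - rpgf K s t x) / (1 - x)) + integral {s..t} (\<lambda>r. \<alpha> r 0)"
  shows "(\<integral>\<^sup>+ r. ennreal (rate r (rpgf K r t x)) * indicator {s..t} r \<partial>lborel) = ennreal c"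
    and "0 \<le> c"
    and "(\<lambda>r. ennreal (rate r (rpgf K r t x)) * indicator {s..t} r) \<in> borel_measurable lebesgue"
proof -
  have y: "0 \<le> rpgf K r t x" "rpgf K r t x < 1" if "r \<in> {s..t}" for r
    using that st x rpgf_nonneg[of x K r t] rpgf_less_1[of r t x] by auto
  have nn: "0 \<le> rate r (rpgf K r t x)" if "r \<in> {s..t}" for r
    using rate_nonneg[OF _ y[OF that]] that st by auto
  have int: "((\<lambda>r. rate r (rpgf K r t x)) has_integral c) {s..t}"
    using has_integral_add[OF rate_has_integral_ln[OF st x] integrable_integral[OF integrable_alpha_0(1)[OF st(1)]]]
    by (simp add: c_def)
  show "(\<integral>\<^sup>+ r. ennreal (rate r (rpgf K r t x)) * indicator {s..t} r \<partial>lborel) = ennreal c"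
    by (rule nn_integral_has_integral_lebesgue'[OF nn int])
  show "0 \<le> c" by (rule has_integral_nonneg[OF int nn])
  have "(\<lambda>r. indicator {s..t} r *\<^sub>R rate r (rpgf K r t x)) \<in> borel_measurable lebesgue"
    by (rule has_integral_implies_lebesgue_measurable[OF int])
  then have "(\<lambda>r. ennreal (indicator {s..t} r *\<^sub>R rate r (rpgf K r t x))) \<in> borel_measurable lebesgue"
    by measurable
  also have "(\<lambda>r. ennreal (indicator {s..t} r *\<^sub>R rate r (rpgf K r t x)))
      = (\<lambda>r. ennreal (rate r (rpgf K r t x)) * indicator {s..t} r)"
    by (auto simp: indicator_def fun_eq_iff)
  finally show "(\<lambda>r. ennreal (rate r (rpgf K r t x)) * indicator {s..t} r) \<in> borel_measurable lebesgue" .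
qed

text \<open>The half of the limit argument that does not require \<open>u\<close> to approach 1: the
  integrand is bounded by its supremum.\<close>

lemma ln_quotient_le_rate_sup_integral:
  assumes st: "0 \<le> s" "s \<le> t" and x: "0 \<le> x" "x < 1"
  shows "ennreal (ln ((1 - rpgf K s t x) / (1 - x)) + integral {s..t} (\<lambda>r. \<alpha> r 0)) \<le> rate_sup_integral s t"
  unfolding rate_nn_integral(1)[OF st x, symmetric] rate_sup_integral_def
proof (rule nn_integral_mono_AE)
  show "AE r in lborel. ennreal (rate r (rpgf K r t x)) * indicator {s..t} r \<le> rate_sup r * indicator {s..t} r"
    using AE_summable_branch_rate
  proof eventually_elim
    case (elim r)
    then show ?case
      using st x rpgf_nonneg[of x K r t] rpgf_less_1[of r t x]
      by (auto simp: indicator_def intro!: rate_le_rate_sup)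
  qed
qed

text \<open>Finite means are assumed from every \<open>r\<close> in the interval because each
  \<open>rpgf K r t\<close> must tend to 1 at 1 for the integrand to increase to
  \<open>rate_sup r\<close>. The third claim makes the argument of \<open>ennreal\<close> in the
  second one recoverable.\<close>

lemma rate_sup_integral_eq:
  assumes st: "0 \<le> s" "s \<le> t" and fin: "\<And>r. r \<in> {s..t} \<Longrightarrow> pmf_mean (K r t 1) < \<infinity>"
  shows "0 < enn2real (pmf_mean (K s t 1))"
    and "rate_sup_integral s t = ennreal (ln (enn2real (pmf_mean (K s t 1))) + integral {s..t} (\<lambda>r. \<alpha> r 0))"
    and "0 \<le> ln (enn2real (pmf_mean (K s t 1))) + integral {s..t} (\<lambda>r. \<alpha> r 0)"
proof -
  \<comment> \<open>Monotone convergence is a statement about sequences, so the left limit at 1 is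
    taken along this increasing sequence.\<close>
  define x where "x = (\<lambda>k. 1 - 1 / real (k + 2))"
  have x: "0 \<le> x k" "x k < 1" for k by (auto simp: x_def)
  have x_mono: "x k \<le> x l" if "k \<le> l" for k l
    using that by (auto simp: x_def intro!: divide_left_mono)
  have "(\<lambda>k. 1 - 1 / real (k + 2)) \<longlonglongrightarrow> 1 - 0"
    by (intro tendsto_intros LIMSEQ_ignore_initial_segment[OF lim_1_over_n])
  then have x_lim: "x \<longlonglongrightarrow> 1" by (simp add: x_def)
  have x_left: "filterlim x (at_left 1) sequentially"
    unfolding filterlim_at using x_lim less_imp_neq[OF x(2)] x(2) by (auto intro!: always_eventually)
  define I where "I = (\<lambda>k r. ennreal (rate r (rpgf K r t (x k))) * indicator {s..t} r)"
  define c where "c = (\<lambda>k. ln ((1 - rpgf K s t (x k)) / (1 - x k)) + integral {s..t} (\<lambda>r. \<alpha> r 0))"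
  have u: "0 \<le> rpgf K r t (x k)" "rpgf K r t (x k) < 1" if "r \<in> {s..t}" for r k
    using that st x[of k] rpgf_nonneg[of "x k" K r t] rpgf_less_1[of r t "x k"] by auto
  have u_mono: "rpgf K r t (x k) \<le> rpgf K r t (x l)" if "k \<le> l" for r k l
    using x[of k] x[of l] x_mono[OF that] by (intro rpgf_mono) auto
  have inc: "incseq I"
    unfolding incseq_def le_fun_def I_def
    using u u_mono st by (auto simp: indicator_def intro!: ennreal_leI rate_mono)
  have p: "(\<Sum>n. pmf (K r t 1) (enat n)) = 1" "summable (\<lambda>n. real n * pmf (K r t 1) (enat n))"
    if "r \<in> {s..t}" for r
    using fin[OF that] unfolding pmf_mean_finite_iff pgf_summable(2) by auto
  have u_lim: "(\<lambda>k. rpgf K r t (x k)) \<longlonglongrightarrow> 1" if "r \<in> {s..t}" for r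
  proof -
    have "(rpgf K r t \<longlongrightarrow> (\<Sum>n. pmf (K r t 1) (enat n))) (at_left 1)"
      unfolding rpgf_def using pgf_summable(1) by (intro powser_tendsto_suminf) auto
    then show ?thesis using filterlim_compose[OF _ x_left] p(1)[OF that] by auto
  qed
  have "rate_sup_integral s t = (\<integral>\<^sup>+ r. (SUP k. I k r) \<partial>lborel)"
    unfolding rate_sup_integral_def
  proof (rule nn_integral_cong_AE)
    show "AE r in lborel. rate_sup r * indicator {s..t} r = (SUP k. I k r)"
      using AE_summable_branch_rate
    proof eventually_elim
      case (elim r)
      show ?case
      proof (cases "r \<in> {s..t}")
        case True
        then have "(SUP k. ennreal (rate r (rpgf K r t (x k)))) = rate_sup r"
          using elim st u u_mono u_lim by (intro SUP_rate) (auto simp: incseq_def)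
        then show ?thesis using True by (simp add: I_def)
      qed (simp add: I_def)
    qed
  qed
  \<comment> \<open>The functions \<open>I k\<close> are known to be measurable only for
    \<open>lebesgue\<close>; passing to the completion leaves the integral unchanged.\<close>
  also have "\<dots> = (\<integral>\<^sup>+ r. (SUP k. I k r) \<partial>lebesgue)" by (simp add: nn_integral_completion)
  also have "\<dots> = (SUP k. integral\<^sup>N lebesgue (I k))"
    by (rule nn_integral_monotone_convergence_SUP[OF inc])
       (use rate_nn_integral(3)[OF st x] in \<open>auto simp: I_def\<close>)
  also have "\<dots> = (SUP k. ennreal (c k))"
    using rate_nn_integral(1)[OF st x] by (simp add: nn_integral_completion I_def c_def)
  finally have SUP: "rate_sup_integral s t = (SUP k. ennreal (c k))" .
  have "incseq (\<lambda>k. integral\<^sup>N lebesgue (I k))"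
    using inc by (auto simp: incseq_def le_fun_def intro!: nn_integral_mono)
  then have "incseq (\<lambda>k. ennreal (c k))"
    using rate_nn_integral(1)[OF st x] by (simp add: nn_integral_completion I_def c_def)
  from LIMSEQ_SUP[OF this] have lim: "(\<lambda>k. ennreal (c k)) \<longlonglongrightarrow> rate_sup_integral s t"
    unfolding SUP .
  define m where "m = (\<Sum>n. real n * pmf (K s t 1) (enat n))"
  have sin: "s \<in> {s..t}" using st by simp
  have m: "enn2real (pmf_mean (K s t 1)) = m"
    using pmf_mean_eq[OF fin[OF sin]] p(2)[OF sin] by (simp add: m_def suminf_nonneg)
  have "m > 0"
  proof (rule ccontr)
    assume "\<not> m > 0"
    moreover have "m \<ge> 0" unfolding m_def using p(2)[OF sin] by (intro suminf_nonneg) auto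
    ultimately have "m = 0" by simp
    then have "\<forall>n. real n * pmf (K s t 1) (enat n) = 0"
      unfolding m_def using p(2)[OF sin] by (subst (asm) suminf_eq_zero_iff) auto
    \<comment> \<open>A zero mean puts all finite mass at the state 0, so the generating function
      would equal 1 at 0, where it is strictly below 1.\<close>
    then have "pmf (K s t 1) (enat n) * 0 ^ n = pmf (K s t 1) (enat n)" for n
      by (cases n) auto
    then have "rpgf K s t 0 = 1" unfolding rpgf_def by (simp only: p(1)[OF sin])
    then show False using rpgf_less_1[of s t 0] st by simp
  qed
  then show "0 < enn2real (pmf_mean (K s t 1))" by (simp add: m)
  have "((\<lambda>x. (1 - rpgf K s t x) / (1 - x)) \<longlongrightarrow> m) (at_left 1)"
    unfolding rpgf_def m_def using pgf_summable(1) p[OF sin]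
    by (intro difference_quotient_tendsto) auto
  from filterlim_compose[OF this x_left]
  have c_lim: "c \<longlonglongrightarrow> ln m + integral {s..t} (\<lambda>r. \<alpha> r 0)"
    unfolding c_def using \<open>m > 0\<close> by (intro tendsto_intros) auto
  show "rate_sup_integral s t = ennreal (ln (enn2real (pmf_mean (K s t 1))) + integral {s..t} (\<lambda>r. \<alpha> r 0))"
    unfolding m by (rule LIMSEQ_unique[OF lim tendsto_ennrealI[OF c_lim]])
  show "0 \<le> ln (enn2real (pmf_mean (K s t 1))) + integral {s..t} (\<lambda>r. \<alpha> r 0)"
    unfolding m by (rule LIMSEQ_le_const[OF c_lim])
      (use rate_nn_integral(2)[OF st x] in \<open>auto simp: c_def\<close>)
qed

lemma pmf_mean_finite_of_rate_sup_integral: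
  assumes fin: "\<And>T. rate_sup_integral 0 T < \<infinity>" and st: "0 \<le> s" "s \<le> t"
  shows "pmf_mean (K s t 1) < \<infinity>"
proof -
  have "rate_sup_integral s t \<le> rate_sup_integral 0 t"
    unfolding rate_sup_integral_def using st by (intro nn_integral_mono) (auto simp: indicator_def)
  with fin[of t] obtain C where C: "0 \<le> C" "rate_sup_integral s t \<le> ennreal C"
    by (metis ennreal_cases infinity_ennreal_def less_irrefl)
  have "(1 - (\<Sum>n. pmf (K s t 1) (enat n) * x ^ n)) / (1 - x) \<le> exp C" if x: "0 < x" "x < 1" for x
  proof -
    have "ennreal (ln ((1 - rpgf K s t x) / (1 - x)) + integral {s..t} (\<lambda>r. \<alpha> r 0)) \<le> ennreal C"
      using ln_quotient_le_rate_sup_integral[OF st, of x] x C(2) by (meson less_imp_le order_trans)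
    then have "ln ((1 - rpgf K s t x) / (1 - x)) \<le> C"
      using C(1) integrable_alpha_0(2)[OF st(1), of t] by (simp add: ennreal_le_iff)
    moreover have "(1 - rpgf K s t x) / (1 - x) > 0" using rpgf_less_1[of s t x] st x by simp
    ultimately have "(1 - rpgf K s t x) / (1 - x) \<le> exp C" by (metis exp_le_cancel_iff exp_ln)
    then show ?thesis by (simp add: rpgf_def)
  qed
  then have "(\<Sum>n. pmf (K s t 1) (enat n)) = 1" "summable (\<lambda>n. real n * pmf (K s t 1) (enat n))"
    using pgf_summable(1,2)[of K s t]
      summable_of_difference_quotient_bounded[of "\<lambda>n. pmf (K s t 1) (enat n)" "exp C"] by auto
  then show ?thesis unfolding pmf_mean_finite_iff pgf_summable(2) by simp
qed

subsection \<open>Boundary behaviour of the vector field\<close>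

text \<open>Local integrability gives measurability of \<open>q\<close> only after cutting off to a
  compact interval, so the case distinction on \<open>q r = 0\<close> in \<open>rate_sup\<close> is
  rewritten through the cut-off function.\<close>

lemma q_indicator_measurable [measurable]: "(\<lambda>r. indicat_real {0..T} r * q r) \<in> borel_measurable borel"
  using gf unfolding generating_family_def L1_loc_def set_integrable_def
  by (auto dest!: spec[of _ T] borel_measurable_integrable)

lemma rate_sup_indicator_measurable [measurable]:
  "(\<lambda>r. rate_sup r * indicator {0..T} r) \<in> borel_measurable borel"
proof -
  have "(\<lambda>r. rate_sup r * indicator {0..T} r) =
    (\<lambda>r. ((if indicat_real {0..T} r * q r = 0 then 0 else top)
        + (\<Sum>n. ennreal (branch_rate \<alpha> r n * real (n - 1)))) * indicator {0..T} r)"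
    by (auto simp: fun_eq_iff rate_sup_def indicator_def)
  also have "\<dots> \<in> borel_measurable borel" by measurable
  finally show ?thesis .
qed

text \<open>The rate condition \<open>C6\<close> of the theorem in terms of
  \<open>branch_rate\<close>; the conditions on the means and on the vector field are both compared
  with it.\<close>

definition first_moment_integrable :: bool where
  "first_moment_integrable \<longleftrightarrow> (AE t in lborel. 0 \<le> t \<longrightarrow> q t = 0) \<and>
     (\<forall>T. (\<integral>\<^sup>+ t. indicator {0..T} t * (\<Sum>n. ennreal ((real n + 1) * branch_rate \<alpha> t n)) \<partial>lborel) < \<infinity>)"

text \<open>The weights \<open>n + 1\<close> and truncated \<open>n - 1\<close> differ by at most 2,
  and twice the total rate is locally integrable for a generating family. A finite integral of
  \<open>rate_sup\<close> also forces \<open>q = 0\<close> almost everywhere, since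
  \<open>rate_sup\<close> is \<open>top\<close> wherever \<open>q\<close> is nonzero.\<close>

lemma first_moment_integrable_iff:
  "first_moment_integrable \<longleftrightarrow> (\<forall>T. rate_sup_integral 0 T < \<infinity>)"
proof
  assume *: first_moment_integrable
  show "\<forall>T. rate_sup_integral 0 T < \<infinity>"
  proof
    fix T
    have "AE r in lborel. 0 \<le> r \<longrightarrow> q r = 0" using * by (simp add: first_moment_integrable_def)
    then have "rate_sup_integral 0 T
      \<le> (\<integral>\<^sup>+ t. indicator {0..T} t * (\<Sum>n. ennreal ((real n + 1) * branch_rate \<alpha> t n)) \<partial>lborel)"
      unfolding rate_sup_integral_def
    proof (intro nn_integral_mono_AE, eventually_elim)
      case (elim r)
      have "(\<Sum>n. ennreal (branch_rate \<alpha> r n * real (n - 1))) \<le> (\<Sum>n. ennreal ((real n + 1) * branch_rate \<alpha> r n))"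
        if "0 \<le> r"
        using branch_rate_nonneg[OF that]
        by (intro suminf_le ennreal_leI) (auto simp: mult.commute[of "branch_rate _ _ _"] intro!: mult_right_mono)
      with elim show ?case by (auto simp: indicator_def rate_sup_def)
    qed
    also have "\<dots> < \<infinity>" using * by (simp add: first_moment_integrable_def)
    finally show "rate_sup_integral 0 T < \<infinity>" .
  qed
next
  assume fin: "\<forall>T. rate_sup_integral 0 T < \<infinity>"
  have "AE t in lborel. 0 \<le> t \<longrightarrow> q t = 0"
  proof (rule AE_nonnegI)
    fix k :: nat
    have "(\<integral>\<^sup>+ r. rate_sup r * indicator {0..real k} r \<partial>lborel) \<noteq> \<infinity>"
      using fin[rule_format, of "real k"] unfolding rate_sup_integral_def by (rule less_imp_neq)
    then have "AE r in lborel. rate_sup r * indicator {0..real k} r \<noteq> \<infinity>"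
      by (intro nn_integral_noteq_infinite) auto
    then show "AE t in lborel. t \<in> {0..real k} \<longrightarrow> q t = 0"
      by eventually_elim (auto simp: rate_sup_def split: if_splits)
  qed
  moreover have "(\<integral>\<^sup>+ t. indicator {0..T} t * (\<Sum>n. ennreal ((real n + 1) * branch_rate \<alpha> t n)) \<partial>lborel) < \<infinity>" for T
  proof -
    have "(\<integral>\<^sup>+ t. indicator {0..T} t * (\<Sum>n. ennreal ((real n + 1) * branch_rate \<alpha> t n)) \<partial>lborel)
      \<le> (\<integral>\<^sup>+ t. rate_sup t * indicator {0..T} t
             + 2 * (indicator {0..T} t * (\<Sum>n. ennreal (branch_rate \<alpha> t n))) \<partial>lborel)"
    proof (rule nn_integral_mono)
      fix t
      have "(\<Sum>n. ennreal ((real n + 1) * branch_rate \<alpha> t n))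
        \<le> (\<Sum>n. ennreal (branch_rate \<alpha> t n * real (n - 1))) + 2 * (\<Sum>n. ennreal (branch_rate \<alpha> t n))"
        if t: "0 \<le> t"
      proof -
        have "ennreal ((real n + 1) * branch_rate \<alpha> t n)
          \<le> ennreal (branch_rate \<alpha> t n * real (n - 1)) + 2 * ennreal (branch_rate \<alpha> t n)" for n
        proof -
          \<comment> \<open>An equality for \<open>n \<ge> 1\<close>; truncated subtraction makes it
            strict at \<open>n = 0\<close>.\<close>
          have "real n + 1 \<le> real (n - 1) + 2" by simp
          then have "(real n + 1) * branch_rate \<alpha> t n \<le> (real (n - 1) + 2) * branch_rate \<alpha> t n"
            using branch_rate_nonneg[OF t] by (rule mult_right_mono)
          then have "ennreal ((real n + 1) * branch_rate \<alpha> t n)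
              \<le> ennreal (branch_rate \<alpha> t n * real (n - 1) + 2 * branch_rate \<alpha> t n)"
            by (intro ennreal_leI) (simp add: algebra_simps)
          then show ?thesis using branch_rate_nonneg[OF t, of n] by (simp add: ennreal_plus ennreal_mult)
        qed
        then have "(\<Sum>n. ennreal ((real n + 1) * branch_rate \<alpha> t n))
          \<le> (\<Sum>n. ennreal (branch_rate \<alpha> t n * real (n - 1)) + 2 * ennreal (branch_rate \<alpha> t n))"
          by (intro suminf_le) auto
        also have "\<dots> = (\<Sum>n. ennreal (branch_rate \<alpha> t n * real (n - 1))) + 2 * (\<Sum>n. ennreal (branch_rate \<alpha> t n))"
          by (subst suminf_add[symmetric]) auto
        finally show ?thesis .
      qed
      then show "indicator {0..T} t * (\<Sum>n. ennreal ((real n + 1) * branch_rate \<alpha> t n))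
         \<le> rate_sup t * indicator {0..T} t + 2 * (indicator {0..T} t * (\<Sum>n. ennreal (branch_rate \<alpha> t n)))"
        by (auto simp: indicator_def rate_sup_def)
    qed
    also have "\<dots> = rate_sup_integral 0 T
        + 2 * (\<integral>\<^sup>+ t. indicator {0..T} t * (\<Sum>n. ennreal (branch_rate \<alpha> t n)) \<partial>lborel)"
      unfolding rate_sup_integral_def by (simp add: nn_integral_add nn_integral_cmult)
    also have "\<dots> < \<infinity>"
      using fin[rule_format, of T] branch_rate_nn_integral_finite[of T] by (simp add: ennreal_mult_less_top)
    finally show ?thesis .
  qed
  ultimately show first_moment_integrable by (simp add: first_moment_integrable_def)
qed

text \<open>Abel continuity of the series lets the total rate cancel at the boundary, so the
  boundary value is \<open>q t\<close> alone.\<close>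

lemma herglotz_tendsto:
  assumes t: "0 \<le> t" "summable (branch_rate \<alpha> t)"
  shows "((\<lambda>x. herglotz q \<alpha> (complex_of_real x) t) \<longlongrightarrow> complex_of_real (q t)) (at_left 1)"
proof -
  let ?b = "branch_rate \<alpha> t"
  have "((\<lambda>x. (q t + suminf ?b) * x - (\<Sum>n. ?b n * x ^ n)) \<longlongrightarrow> (q t + suminf ?b) * 1 - suminf ?b) (at_left 1)"
    by (intro tendsto_intros powser_tendsto_suminf branch_rate_nonneg t)
  then have "((\<lambda>x. complex_of_real ((q t + suminf ?b) * x - (\<Sum>n. ?b n * x ^ n))) \<longlongrightarrow> complex_of_real (q t)) (at_left 1)"
    by (intro tendsto_of_real) simp
  moreover have "eventually (\<lambda>x. complex_of_real ((q t + suminf ?b) * x - (\<Sum>n. ?b n * x ^ n))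
      = herglotz q \<alpha> (complex_of_real x) t) (at_left 1)"
    using eventually_at_left_real[OF zero_less_one]
  proof eventually_elim
    case (elim x)
    have "summable (\<lambda>n. ?b n * x ^ n)"
      using elim t branch_rate_nonneg by (intro summable_powser_nonneg_real) auto
    from powser_complex_of_real[OF this] elim t show ?case by (simp add: herglotz_eq)
  qed
  ultimately show ?thesis by (rule Lim_transform_eventually)
qed

lemma deriv_herglotz:
  assumes t: "0 \<le> t" "summable (branch_rate \<alpha> t)" and z: "norm z < 1"
  shows "deriv (\<lambda>w. herglotz q \<alpha> w t) z = of_real (q t + suminf (branch_rate \<alpha> t))
            - deriv (\<lambda>w. \<Sum>n. of_real (branch_rate \<alpha> t n) * w ^ n) z"
proof -
  let ?G = "\<lambda>w. \<Sum>n. complex_of_real (branch_rate \<alpha> t n) * w ^ n"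
  have ev: "eventually (\<lambda>w. herglotz q \<alpha> w t = of_real (q t + suminf (branch_rate \<alpha> t)) * w - ?G w) (nhds z)"
    by (rule eventually_mono[OF eventually_nhds_in_open[of "ball 0 1" z] herglotz_eq[OF t]]) (use z in auto)
  have "?G field_differentiable at z"
    using deriv_powser_of_real[OF branch_rate_nonneg[OF t(1)] t(2) z] by (auto simp: field_differentiable_def)
  then have "(?G has_field_derivative deriv ?G z) (at z)" by (simp add: DERIV_deriv_iff_field_differentiable)
  then have "((\<lambda>w. of_real (q t + suminf (branch_rate \<alpha> t)) * w - ?G w) has_field_derivative
      of_real (q t + suminf (branch_rate \<alpha> t)) - deriv ?G z) (at z)"
    by (auto intro!: derivative_eq_intros)
  then show ?thesis unfolding deriv_cong_ev[OF ev refl] by (rule DERIV_imp_deriv)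
qed

text \<open>\<open>\<Phi>'(1, t)\<close> in the case \<open>q\<^sub>t = 0\<close>.\<close>

definition drift :: "real \<Rightarrow> real" where
  "drift t = (\<Sum>n. branch_rate \<alpha> t n) - (\<Sum>n. real n * branch_rate \<alpha> t n)"

text \<open>Subtracting from the constant \<open>q t + suminf (branch_rate \<alpha> t)\<close>
  isolates the derivative of a series with nonnegative coefficients, for which existence of the
  boundary limit is equivalent to a finite first moment.\<close>

lemma deriv_herglotz_tendsto:
  assumes t: "0 \<le> t" "summable (branch_rate \<alpha> t)"
  shows "summable (\<lambda>n. real n * branch_rate \<alpha> t n) \<Longrightarrow>
     ((\<lambda>x. deriv (\<lambda>w. herglotz q \<alpha> w t) (complex_of_real x)) \<longlongrightarrow> complex_of_real (q t + drift t)) (at_left 1)"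
    and "((\<lambda>x. deriv (\<lambda>w. herglotz q \<alpha> w t) (complex_of_real x)) \<longlongrightarrow> L) (at_left 1) \<Longrightarrow>
       summable (\<lambda>n. real n * branch_rate \<alpha> t n)"
proof -
  let ?b = "branch_rate \<alpha> t" and ?G = "\<lambda>w. \<Sum>n. complex_of_real (branch_rate \<alpha> t n) * w ^ n"
  let ?H = "\<lambda>x. deriv (\<lambda>w. herglotz q \<alpha> w t) (complex_of_real x)"
  note b = branch_rate_nonneg[OF t(1)] t(2)
  have ev: "eventually (\<lambda>x. ?H x = of_real (q t + suminf ?b) - deriv ?G (complex_of_real x)) (at_left 1)"
    using eventually_at_left_real[OF zero_less_one]
    by eventually_elim (rule deriv_herglotz[OF t], auto)
  {
    assume "summable (\<lambda>n. real n * ?b n)"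
    from deriv_powser_tendsto(1)[OF b this]
    have "((\<lambda>x. of_real (q t + suminf ?b) - deriv ?G (complex_of_real x)) \<longlongrightarrow>
        of_real (q t + suminf ?b) - complex_of_real (\<Sum>n. real n * ?b n)) (at_left 1)"
      by (intro tendsto_intros)
    moreover have "complex_of_real (q t + suminf ?b) - complex_of_real (\<Sum>n. real n * ?b n)
        = complex_of_real (q t + drift t)" by (simp add: drift_def)
    ultimately show "(?H \<longlongrightarrow> complex_of_real (q t + drift t)) (at_left 1)"
      unfolding tendsto_cong[OF ev] by (simp only:)
  }
  assume "(?H \<longlongrightarrow> L) (at_left 1)"
  then have "((\<lambda>x. of_real (q t + suminf ?b) - deriv ?G (complex_of_real x)) \<longlongrightarrow> L) (at_left 1)"
    unfolding tendsto_cong[OF ev] .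
  then have "((\<lambda>x. of_real (q t + suminf ?b)
      - (of_real (q t + suminf ?b) - deriv ?G (complex_of_real x))) \<longlongrightarrow> of_real (q t + suminf ?b) - L) (at_left 1)"
    by (intro tendsto_intros)
  then have "((\<lambda>x. deriv ?G (complex_of_real x)) \<longlongrightarrow> of_real (q t + suminf ?b) - L) (at_left 1)" by simp
  then show "summable (\<lambda>n. real n * ?b n)" by (rule deriv_powser_tendsto(2)[OF b])
qed

lemma AE_summable_first_moment:
  assumes first_moment_integrable
  shows "AE t in lborel. 0 \<le> t \<longrightarrow> summable (\<lambda>n. (real n + 1) * branch_rate \<alpha> t n)"
proof (rule AE_nonnegI)
  fix k :: nat
  have "(\<integral>\<^sup>+ t. indicator {0..real k} t * (\<Sum>n. ennreal ((real n + 1) * branch_rate \<alpha> t n)) \<partial>lborel) \<noteq> \<infinity>"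
    using assms by (simp add: first_moment_integrable_def less_top)
  then have "AE t in lborel. indicator {0..real k} t * (\<Sum>n. ennreal ((real n + 1) * branch_rate \<alpha> t n)) \<noteq> \<infinity>"
    by (intro nn_integral_noteq_infinite) auto
  then show "AE t in lborel. t \<in> {0..real k} \<longrightarrow> summable (\<lambda>n. (real n + 1) * branch_rate \<alpha> t n)"
    by eventually_elim (auto intro!: summable_suminf_not_top mult_nonneg_nonneg branch_rate_nonneg)
qed

lemma summable_first_moment:
  assumes "0 \<le> t" "summable (branch_rate \<alpha> t)"
  shows "summable (\<lambda>n. (real n + 1) * branch_rate \<alpha> t n) \<longleftrightarrow> summable (\<lambda>n. real n * branch_rate \<alpha> t n)"
    and "summable (\<lambda>n. real n * branch_rate \<alpha> t n) \<Longrightarrow>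
      (\<Sum>n. (real n + 1) * branch_rate \<alpha> t n) = 2 * (\<Sum>n. branch_rate \<alpha> t n) - drift t"
proof -
  show "summable (\<lambda>n. (real n + 1) * branch_rate \<alpha> t n) \<longleftrightarrow> summable (\<lambda>n. real n * branch_rate \<alpha> t n)"
    using summable_add[OF _ assms(2), of "\<lambda>n. real n * branch_rate \<alpha> t n"]
      summable_diff[OF _ assms(2), of "\<lambda>n. (real n + 1) * branch_rate \<alpha> t n"]
    by (auto simp: algebra_simps)
  assume "summable (\<lambda>n. real n * branch_rate \<alpha> t n)"
  from suminf_add[OF this assms(2)]
  show "(\<Sum>n. (real n + 1) * branch_rate \<alpha> t n) = 2 * (\<Sum>n. branch_rate \<alpha> t n) - drift t"
    by (simp add: drift_def algebra_simps)
qed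

lemma L1_loc_drift:
  assumes first_moment_integrable
  shows "L1_loc drift"
  unfolding L1_loc_def
proof
  fix T
  show "set_integrable lborel {0..T} drift"
    unfolding set_integrable_def
  proof (rule integrableI_bounded)
    show "(\<lambda>t. indicat_real {0..T} t *\<^sub>R drift t) \<in> borel_measurable lborel"
      unfolding drift_def by measurable
    have "(\<integral>\<^sup>+ t. ennreal (norm (indicat_real {0..T} t *\<^sub>R drift t)) \<partial>lborel)
      \<le> (\<integral>\<^sup>+ t. indicator {0..T} t * (\<Sum>n. ennreal ((real n + 1) * branch_rate \<alpha> t n)) \<partial>lborel)"
    proof (rule nn_integral_mono_AE)
      show "AE t in lborel. ennreal (norm (indicat_real {0..T} t *\<^sub>R drift t))
          \<le> indicator {0..T} t * (\<Sum>n. ennreal ((real n + 1) * branch_rate \<alpha> t n))"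
        using AE_summable_first_moment[OF assms] AE_summable_branch_rate
      proof eventually_elim
        case (elim t)
        show ?case
        proof (cases "t \<in> {0..T}")
          case True
          then have t: "0 \<le> t" by simp
          have s: "summable (\<lambda>n. real n * branch_rate \<alpha> t n)" "summable (branch_rate \<alpha> t)"
            "summable (\<lambda>n. (real n + 1) * branch_rate \<alpha> t n)"
            using elim t summable_first_moment(1)[OF t] by auto
          have nn: "0 \<le> (\<Sum>n. real n * branch_rate \<alpha> t n)" "0 \<le> (\<Sum>n. branch_rate \<alpha> t n)"
            using s branch_rate_nonneg[OF t] by (auto intro!: suminf_nonneg)
          \<comment> \<open>A difference of two nonnegative sums is bounded by their sum, which is
            the series with weights \<open>n + 1\<close>.\<close>
          have "\<bar>drift t\<bar> \<le> (\<Sum>n. (real n + 1) * branch_rate \<alpha> t n)"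
            unfolding summable_first_moment(2)[OF t s(2,1)] using nn by (simp add: drift_def)
          moreover have "(\<Sum>n. ennreal ((real n + 1) * branch_rate \<alpha> t n)) = ennreal (\<Sum>n. (real n + 1) * branch_rate \<alpha> t n)"
            using s branch_rate_nonneg[OF t] by (intro suminf_ennreal2) auto
          ultimately show ?thesis using True by (simp add: ennreal_leI)
        qed simp
      qed
    qed
    also have "\<dots> < \<infinity>" using assms by (simp add: first_moment_integrable_def)
    finally show "(\<integral>\<^sup>+ t. ennreal (norm (indicat_real {0..T} t *\<^sub>R drift t)) \<partial>lborel) < \<infinity>" .
  qed
qed

lemma AE_deriv_herglotz_tendsto:
  assumes first_moment_integrable
  shows "AE t in lborel. 0 \<le> t \<longrightarrow>
     ((\<lambda>x. deriv (\<lambda>w. herglotz q \<alpha> w t) (complex_of_real x)) \<longlongrightarrow> complex_of_real (drift t)) (at_left 1)"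
proof -
  have "AE t in lborel. 0 \<le> t \<longrightarrow> q t = 0" using assms by (simp add: first_moment_integrable_def)
  then show ?thesis
    using AE_summable_first_moment[OF assms] AE_summable_branch_rate
  proof eventually_elim
    case (elim t)
    then show ?case using summable_first_moment(1)[of t] deriv_herglotz_tendsto(1)[of t] by auto
  qed
qed

text \<open>From left to right, the vanishing boundary value gives \<open>q = 0\<close>, and
  uniqueness of limits identifies \<open>g\<close> with \<open>drift\<close>. The series with
  weights \<open>n + 1\<close> is twice the total rate minus \<open>drift\<close>, hence at most
  twice the total rate plus \<open>\<bar>g\<bar>\<close>, and both are locally integrable.\<close>

lemma herglotz_boundary_iff:
  "((AE t in lborel. 0 \<le> t \<longrightarrow> ((\<lambda>x. herglotz q \<alpha> (complex_of_real x) t) \<longlongrightarrow> 0) (at_left 1)) \<and>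
    (\<exists>g. L1_loc g \<and> (AE t in lborel. 0 \<le> t \<longrightarrow>
       ((\<lambda>x. deriv (\<lambda>w. herglotz q \<alpha> w t) (complex_of_real x)) \<longlongrightarrow> complex_of_real (g t)) (at_left 1))))
   \<longleftrightarrow> first_moment_integrable" (is "?L \<and> (\<exists>g. ?R g) \<longleftrightarrow> _")
proof
  assume fmi: first_moment_integrable
  then have "AE t in lborel. 0 \<le> t \<longrightarrow> q t = 0" by (simp add: first_moment_integrable_def)
  with AE_summable_branch_rate have ?L
  proof eventually_elim
    case (elim t)
    then show ?case using herglotz_tendsto[of t] by auto
  qed
  moreover have "?R drift" using L1_loc_drift[OF fmi] AE_deriv_herglotz_tendsto[OF fmi] by blast
  ultimately show "?L \<and> (\<exists>g. ?R g)" by blast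
next
  assume *: "?L \<and> (\<exists>g. ?R g)"
  then obtain g where g: "L1_loc g" and lim: "AE t in lborel. 0 \<le> t \<longrightarrow>
       ((\<lambda>x. deriv (\<lambda>w. herglotz q \<alpha> w t) (complex_of_real x)) \<longlongrightarrow> complex_of_real (g t)) (at_left 1)"
    by blast
  from * have ?L by blast
  with AE_summable_branch_rate have q0: "AE t in lborel. 0 \<le> t \<longrightarrow> q t = 0"
  proof eventually_elim
    case (elim t)
    show ?case
    proof
      assume t: "0 \<le> t"
      have "complex_of_real (q t) = 0"
        using tendsto_unique[OF trivial_limit_at_left_real herglotz_tendsto[of t]] elim t by blast
      then show "q t = 0" by simp
    qed
  qed
  have "(\<integral>\<^sup>+ t. indicator {0..T} t * (\<Sum>n. ennreal ((real n + 1) * branch_rate \<alpha> t n)) \<partial>lborel) < \<infinity>" for T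
  proof -
    have g_int: "integrable lborel (\<lambda>t. indicat_real {0..T} t *\<^sub>R g t)"
      using g by (simp add: L1_loc_def set_integrable_def)
    then have [measurable]: "(\<lambda>t. indicat_real {0..T} t * g t) \<in> borel_measurable borel" by auto
    have "(\<integral>\<^sup>+ t. indicator {0..T} t * (\<Sum>n. ennreal ((real n + 1) * branch_rate \<alpha> t n)) \<partial>lborel)
      \<le> (\<integral>\<^sup>+ t. 2 * (indicator {0..T} t * (\<Sum>n. ennreal (branch_rate \<alpha> t n)))
            + ennreal (norm (indicat_real {0..T} t *\<^sub>R g t)) \<partial>lborel)"
    proof (rule nn_integral_mono_AE)
      show "AE t in lborel. indicator {0..T} t * (\<Sum>n. ennreal ((real n + 1) * branch_rate \<alpha> t n))
        \<le> 2 * (indicator {0..T} t * (\<Sum>n. ennreal (branch_rate \<alpha> t n)))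
            + ennreal (norm (indicat_real {0..T} t *\<^sub>R g t))"
        using lim q0 AE_summable_branch_rate
      proof eventually_elim
        case (elim t)
        show ?case
        proof (cases "t \<in> {0..T}")
          case True
          then have t: "0 \<le> t" by simp
          have sb: "summable (branch_rate \<alpha> t)" and qt: "q t = 0"
            and gt: "((\<lambda>x. deriv (\<lambda>w. herglotz q \<alpha> w t) (complex_of_real x)) \<longlongrightarrow> complex_of_real (g t)) (at_left 1)"
            using elim t by auto
          have sn: "summable (\<lambda>n. real n * branch_rate \<alpha> t n)"
            by (rule deriv_herglotz_tendsto(2)[OF t sb gt])
          have "complex_of_real (g t) = complex_of_real (q t + drift t)"
            by (rule tendsto_unique[OF trivial_limit_at_left_real gt deriv_herglotz_tendsto(1)[OF t sb sn]])
          then have gd: "drift t = g t" using qt by simp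
          have "(\<Sum>n. ennreal ((real n + 1) * branch_rate \<alpha> t n)) = ennreal (\<Sum>n. (real n + 1) * branch_rate \<alpha> t n)"
            using sn summable_first_moment(1)[OF t sb] branch_rate_nonneg[OF t] by (intro suminf_ennreal2) auto
          also have "\<dots> \<le> ennreal (2 * (\<Sum>n. branch_rate \<alpha> t n) + \<bar>g t\<bar>)"
            unfolding summable_first_moment(2)[OF t sb sn] gd by (intro ennreal_leI) simp
          also have "\<dots> = 2 * (\<Sum>n. ennreal (branch_rate \<alpha> t n)) + ennreal \<bar>g t\<bar>"
            using sb branch_rate_nonneg[OF t]
            by (simp add: suminf_ennreal2 ennreal_plus ennreal_mult suminf_nonneg)
          finally show ?thesis using True by simp
        qed simp
      qed
    qed
    also have "\<dots> = 2 * (\<integral>\<^sup>+ t. indicator {0..T} t * (\<Sum>n. ennreal (branch_rate \<alpha> t n)) \<partial>lborel)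
        + (\<integral>\<^sup>+ t. ennreal (norm (indicat_real {0..T} t *\<^sub>R g t)) \<partial>lborel)"
      by (subst nn_integral_add) (auto simp: nn_integral_cmult)
    also have "\<dots> < \<infinity>"
      using g_int branch_rate_nn_integral_finite[of T] unfolding integrable_iff_bounded
      by (simp add: ennreal_mult_less_top)
    finally show ?thesis .
  qed
  with q0 show first_moment_integrable by (simp add: first_moment_integrable_def)
qed

section \<open>Finiteness of the means and the exponential formula\<close>

lemma pmf_mean_finite_iff_first_moment:
  "(\<forall>s t. 0 \<le> s \<and> s \<le> t \<longrightarrow> pmf_mean (K s t 1) < \<infinity>) \<longleftrightarrow> first_moment_integrable"
proof
  assume fin: "\<forall>s t. 0 \<le> s \<and> s \<le> t \<longrightarrow> pmf_mean (K s t 1) < \<infinity>"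
  have "rate_sup_integral 0 T < \<infinity>" for T
  proof (cases "0 \<le> T")
    case True
    then have "rate_sup_integral 0 T
       = ennreal (ln (enn2real (pmf_mean (K 0 T 1))) + integral {0..T} (\<lambda>r. \<alpha> r 0))"
      using fin by (intro rate_sup_integral_eq) auto
    then show ?thesis by simp
  qed (simp add: rate_sup_integral_def)
  then show first_moment_integrable by (simp add: first_moment_integrable_iff)
next
  assume first_moment_integrable
  then show "\<forall>s t. 0 \<le> s \<and> s \<le> t \<longrightarrow> pmf_mean (K s t 1) < \<infinity>"
    using pmf_mean_finite_of_rate_sup_integral unfolding first_moment_integrable_iff by blast
qed

text \<open>When \<open>q\<close> vanishes, \<open>rate_sup\<close> equals \<alpha>(0) minus
  \<open>drift\<close> almost everywhere, so the integral of \<alpha>(0) appears on both sides of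
  the logarithmic identity and cancels.\<close>

lemma pmf_mean_eq_exp_drift:
  assumes fmi: first_moment_integrable and st: "0 \<le> s" "s \<le> t"
  shows "enn2real (pmf_mean (K s t 1)) = exp (- integral {s..t} drift)"
proof -
  have fin: "pmf_mean (K r t 1) < \<infinity>" if "r \<in> {s..t}" for r
    using fmi pmf_mean_finite_iff_first_moment st that by auto
  note eq = rate_sup_integral_eq[OF st fin]
  \<comment> \<open>Clamping at zero makes the function nonnegative at every point, as the passage
    from gauge to nonnegative integral asks; almost everywhere it changes nothing.\<close>
  define f where "f = (\<lambda>r. max 0 (\<alpha> r 0 - drift r))"
  have AE_f: "AE r in lborel. 0 \<le> r \<longrightarrow> \<alpha> r 0 - drift r = f r \<and> rate_sup r = ennreal (f r)"
  proof -
    have "AE t in lborel. 0 \<le> t \<longrightarrow> q t = 0" using fmi by (simp add: first_moment_integrable_def)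
    then show ?thesis
      using AE_summable_first_moment[OF fmi] AE_summable_branch_rate
    proof eventually_elim
      case (elim r)
      show ?case
      proof
        assume r: "0 \<le> r"
        let ?b = "branch_rate \<alpha> r"
        have sb: "summable ?b" and sn: "summable (\<lambda>n. real n * ?b n)"
          using elim r summable_first_moment(1)[OF r] by auto
        have "(\<lambda>n. real n * ?b n - ?b n + (if n = 0 then \<alpha> r 0 else 0)) sums
            ((\<Sum>n. real n * ?b n) - (\<Sum>n. ?b n) + \<alpha> r 0)"
          by (intro sums_add sums_diff summable_sums sb sn sums_single)
        \<comment> \<open>At \<open>n = 0\<close> the left side would be minus \<alpha>(0), while
          truncated subtraction gives 0; the added term repairs this.\<close>
        moreover have "real n * ?b n - ?b n + (if n = 0 then \<alpha> r 0 else 0) = ?b n * real (n - 1)" for n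
          by (cases n) (auto simp: branch_rate_def algebra_simps)
        ultimately have s: "(\<lambda>n. ?b n * real (n - 1)) sums (\<alpha> r 0 - drift r)"
          by (simp add: drift_def algebra_simps)
        have nn: "0 \<le> ?b n * real (n - 1)" for n using branch_rate_nonneg[OF r, of n] by simp
        have "0 \<le> \<alpha> r 0 - drift r" using sums_le[OF nn sums_zero s] by simp
        moreover have "rate_sup r = ennreal (\<alpha> r 0 - drift r)"
          using elim r suminf_ennreal_eq[OF nn s] by (simp add: rate_sup_def)
        ultimately show "\<alpha> r 0 - drift r = f r \<and> rate_sup r = ennreal (f r)" by (simp add: f_def)
      qed
    qed
  qed
  define A where "A = integral {s..t} (\<lambda>r. \<alpha> r 0)"
  have "((\<lambda>r. \<alpha> r 0 - drift r) has_integral (A - integral {s..t} drift)) {s..t}"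
    unfolding A_def
    by (intro has_integral_diff integrable_integral integrable_alpha_0 L1_loc_integrable_on(2)[OF L1_loc_drift[OF fmi]] st)
  note int = this
  obtain S where S: "negligible S" "\<And>r. r \<notin> S \<Longrightarrow> 0 \<le> r \<longrightarrow> \<alpha> r 0 - drift r = f r \<and> rate_sup r = ennreal (f r)"
    using AE_lborel_negligibleE[OF AE_f] by blast
  have "f r = \<alpha> r 0 - drift r" if "r \<in> {s..t} - S" for r using S(2)[of r] that st by auto
  then have f_int: "(f has_integral (A - integral {s..t} drift)) {s..t}"
    by (rule has_integral_spike[OF S(1) _ int])
  have f0: "0 \<le> f r" for r by (simp add: f_def)
  have "rate_sup_integral s t = (\<integral>\<^sup>+ r. ennreal (f r) * indicator {s..t} r \<partial>lborel)"
    unfolding rate_sup_integral_def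
  proof (rule nn_integral_cong_AE)
    show "AE r in lborel. rate_sup r * indicator {s..t} r = ennreal (f r) * indicator {s..t} r"
      using AE_f by eventually_elim (use st in \<open>auto simp: indicator_def\<close>)
  qed
  also have "\<dots> = ennreal (A - integral {s..t} drift)"
    by (rule nn_integral_has_integral_lebesgue'[OF f0 f_int])
  \<comment> \<open>Two \<open>ennreal\<close> values are compared; both arguments are nonnegative,
    so the real numbers agree.\<close>
  finally have "ln (enn2real (pmf_mean (K s t 1))) + A = A - integral {s..t} drift"
    using eq(2,3) has_integral_nonneg[OF f_int f0] by (simp add: A_def)
  then have "ln (enn2real (pmf_mean (K s t 1))) = - integral {s..t} drift" by simp
  with eq(1) show ?thesis by (metis exp_ln)
qed

text \<open>Where the boundary limit fails, \<open>bval1\<close> may take an arbitrary value, but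
  only on a null set, which the gauge integral ignores.\<close>

lemma integral_bval1_deriv_herglotz:
  assumes fmi: first_moment_integrable and st: "0 \<le> s"
  shows "integral {s..t} (\<lambda>r. bval1 (deriv (\<lambda>w. herglotz q \<alpha> w r))) = complex_of_real (integral {s..t} drift)"
proof (rule integral_unique)
  obtain S where S: "negligible S" "\<And>r. r \<notin> S \<Longrightarrow> 0 \<le> r \<longrightarrow>
     ((\<lambda>x. deriv (\<lambda>w. herglotz q \<alpha> w r) (complex_of_real x)) \<longlongrightarrow> complex_of_real (drift r)) (at_left 1)"
    using AE_lborel_negligibleE[OF AE_deriv_herglotz_tendsto[OF fmi]] by blast
  have "((complex_of_real \<circ> drift) has_integral complex_of_real (integral {s..t} drift)) {s..t}"
    by (intro has_integral_linear[OF _ bounded_linear_of_real] integrable_integral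
        L1_loc_integrable_on(2)[OF L1_loc_drift[OF fmi] st])
  then show "((\<lambda>r. bval1 (deriv (\<lambda>w. herglotz q \<alpha> w r))) has_integral complex_of_real (integral {s..t} drift)) {s..t}"
    by (rule has_integral_spike[OF S(1), rotated]) (use S(2) st in \<open>auto intro!: bval1_eqI\<close>)
qed

end

theorem mainTheorem18:
  fixes P :: "real \<Rightarrow> enat \<Rightarrow> 'w measure" and N :: "real \<Rightarrow> 'w \<Rightarrow> enat"
    and K :: "real \<Rightarrow> real \<Rightarrow> enat \<Rightarrow> enat pmf"
    and q :: "real \<Rightarrow> real" and \<alpha> :: "real \<Rightarrow> nat \<Rightarrow> real"
  assumes bp: "branching_process P N K"
    and ef: "ac_reverse_evolution_family (pgf K)"
    and gf: "generating_family q \<alpha>"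
    and hvf: "\<forall>t z. 0 \<le> t \<and> z \<in> ball 0 1 \<longrightarrow>
       (AE s in lborel. s \<in> {0..t} \<longrightarrow>
          ((\<lambda>s'. pgf K s' t z) has_vector_derivative herglotz q \<alpha> (pgf K s t z) s) (at s within {0..t}))"
  defines "C1 \<equiv> (\<forall>n::nat. \<forall>s t. 1 \<le> n \<and> 0 \<le> s \<and> s \<le> t \<longrightarrow> expect_N P N s (enat n) t < \<infinity>)"
    and "C2 \<equiv> (\<forall>t. 0 \<le> t \<longrightarrow> expect_N P N 0 1 t < \<infinity>)"
    and "C3 \<equiv> (\<forall>t. 0 \<le> t \<longrightarrow>
              ((\<lambda>x. pgf K 0 t (complex_of_real x)) \<longlongrightarrow> 1) (at_left 1) \<and>
              (\<exists>L. ((\<lambda>x. deriv (pgf K 0 t) (complex_of_real x)) \<longlongrightarrow> L) (at_left 1)))"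
    and "C4 \<equiv> (\<forall>s t. 0 \<le> s \<and> s \<le> t \<longrightarrow>
              ((\<lambda>x. pgf K s t (complex_of_real x)) \<longlongrightarrow> 1) (at_left 1) \<and>
              (\<exists>L. ((\<lambda>x. deriv (pgf K s t) (complex_of_real x)) \<longlongrightarrow> L) (at_left 1)))"
    and "C5 \<equiv> ((AE t in lborel. 0 \<le> t \<longrightarrow>
                 ((\<lambda>x. herglotz q \<alpha> (complex_of_real x) t) \<longlongrightarrow> 0) (at_left 1)) \<and>
              (\<exists>g. L1_loc g \<and>
                 (AE t in lborel. 0 \<le> t \<longrightarrow>
                   ((\<lambda>x. deriv (\<lambda>w. herglotz q \<alpha> w t) (complex_of_real x))
                      \<longlongrightarrow> complex_of_real (g t)) (at_left 1))))"
    and "C6 \<equiv> ((AE t in lborel. 0 \<le> t \<longrightarrow> q t = 0) \<and>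
              (\<forall>T. (\<integral>\<^sup>+ t. indicator {0..T} t *
                     (\<Sum>n. ennreal (if n = 1 then 0 else (real n + 1) * \<alpha> t n)) \<partial>lborel) < \<infinity>))"
  shows "(C1 \<longleftrightarrow> C2) \<and> (C2 \<longleftrightarrow> C3) \<and> (C3 \<longleftrightarrow> C4) \<and> (C4 \<longleftrightarrow> C5) \<and> (C5 \<longleftrightarrow> C6) \<and>
         (C1 \<longrightarrow> (\<forall>n::nat. \<forall>s t. 1 \<le> n \<and> 0 \<le> s \<and> s \<le> t \<longrightarrow>
             complex_of_real (enn2real (expect_N P N s (enat n) t))
               = of_nat n * bval1 (deriv (pgf K s t)) \<and>
             of_nat n * bval1 (deriv (pgf K s t))
               = of_nat n * exp (- integral {s..t} (\<lambda>r. bval1 (deriv (\<lambda>w. herglotz q \<alpha> w r))))))"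
proof -
  interpret branching_evolution K q \<alpha> by unfold_locales (fact ef gf hvf)+
  have K: "branching_kernels K" using bp by (simp add: branching_process_def)
  \<comment> \<open>The conditions on expectations and generating functions are matched with
    \<open>all_finite\<close>, those on \<Phi> and the rates with
    \<open>first_moment_integrable\<close>; the link between these two is the analytic core.\<close>
  define all_finite where "all_finite \<longleftrightarrow> (\<forall>s t. 0 \<le> s \<and> s \<le> t \<longrightarrow> pmf_mean (K s t 1) < \<infinity>)"
  have mean_n: "expect_N P N s (enat n) t = of_nat n * pmf_mean (K s t 1)" if "0 \<le> s" "s \<le> t" for s t n
    using expect_N_eq_pmf_mean[OF bp that] pmf_mean_branching_kernels_mult[OF K that] by simp
  have mean_1: "expect_N P N s 1 t = pmf_mean (K s t 1)" if "0 \<le> s" "s \<le> t" for s t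
    by (rule expect_N_eq_pmf_mean[OF bp that])
  have c2: "C2 \<longleftrightarrow> all_finite"
  proof
    assume C2
    then have fin: "pmf_mean (K 0 t 1) < \<infinity>" if "0 \<le> t" for t
      unfolding C2_def mean_1[OF order_refl that, symmetric] using that by blast
    \<comment> \<open>The probability of the state 0 is the generating function at 0, and the
      evolution family maps the open disc into itself.\<close>
    have "pmf (K 0 s 1) 0 < 1" if "0 \<le> s" for s
      using rpgf_less_1[of 0 s 0] that by (simp add: rpgf_def zero_enat_def)
    then show all_finite
      unfolding all_finite_def by (metis pmf_mean_branching_kernels_shift[OF K] fin order_trans)
  next
    assume all_finite
    then show C2 unfolding C2_def all_finite_def using mean_1 by simp
  qed
  have c1: "C1 \<longleftrightarrow> all_finite"
  proof
    assume C1
    then have "expect_N P N s (enat 1) t < \<infinity>" if "0 \<le> s" "s \<le> t" for s t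
      using that unfolding C1_def by blast
    then show all_finite unfolding all_finite_def using mean_n[of _ _ 1] by simp
  next
    assume all_finite
    then show C1 unfolding C1_def all_finite_def using mean_n
      by (auto simp: ennreal_mult_less_top of_nat_less_top)
  qed
  have c3: "C3 \<longleftrightarrow> C2"
    unfolding C3_def C2_def pmf_mean_finite_iff_pgf[symmetric] using mean_1 by simp
  have c4: "C4 \<longleftrightarrow> all_finite"
    unfolding C4_def all_finite_def pmf_mean_finite_iff_pgf[symmetric] ..
  have c5: "C5 \<longleftrightarrow> first_moment_integrable"
    unfolding C5_def by (rule herglotz_boundary_iff)
  have "(if n = 1 then 0 else (real n + 1) * \<alpha> t n) = (real n + 1) * branch_rate \<alpha> t n" for n t
    by (simp add: branch_rate_def)
  then have c6: "C6 \<longleftrightarrow> first_moment_integrable"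
    unfolding C6_def first_moment_integrable_def by simp
  have fmi: "all_finite \<longleftrightarrow> first_moment_integrable"
    unfolding all_finite_def by (rule pmf_mean_finite_iff_first_moment)
  have formula: "complex_of_real (enn2real (expect_N P N s (enat n) t)) = of_nat n * bval1 (deriv (pgf K s t)) \<and>
      of_nat n * bval1 (deriv (pgf K s t))
        = of_nat n * exp (- integral {s..t} (\<lambda>r. bval1 (deriv (\<lambda>w. herglotz q \<alpha> w r))))"
    if all_finite and st: "0 \<le> s" "s \<le> t" for n s t
  proof -
    have F: first_moment_integrable using that(1) fmi by simp
    have fin: "pmf_mean (K s t 1) < \<infinity>" using that unfolding all_finite_def by blast
    have "complex_of_real (exp (- integral {s..t} drift))
        = exp (- integral {s..t} (\<lambda>r. bval1 (deriv (\<lambda>w. herglotz q \<alpha> w r))))"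
      unfolding integral_bval1_deriv_herglotz[OF F st(1)] by (simp add: exp_of_real[symmetric])
    then show ?thesis
      unfolding mean_n[OF st] bval1_deriv_pgf[of K s t, OF fin]
      using pmf_mean_eq_exp_drift[OF F st] by (simp add: enn2real_mult)
  qed
  show ?thesis using c1 c2 c3 c4 c5 c6 fmi formula by blast
qed

end
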